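(* Let $p$ be an odd prime, let $G$ be a finite $p$-group, and let $k,i$ be positive integers such that either $k\leq p-2$ and $i\geq 1$, or $k=p-1$ and $i\geq 2$. Then the following conditions are equivalent: (1) $\gamma_k(G)\leq G^{p^i}$; (2) $|G:G^{p^i}\gamma_k(G)|=|\Omega_{\{i\}}(G)|$.
   Context: $G^{p^i}$ denotes the subgroup generated by all $p^i$-th powers of elements of $G$. $\gamma_k(G)$ denotes the $k$-th term of the lower central series: $\gamma_1(G)=G$ and $\gamma_{k+1}(G)=[\gamma_k(G),G]$. $\Omega_{\{i\}}(G)=\{g\in G\mid g^{p^i}=1\}$ is the subset (not necessarily a subgroup) of elements of $G$ of order dividing $p^i$. *)

theory Defs
  imports "HOL-Algebra.Algebra" "HOL-Computational_Algebra.Primes"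
begin

definition finite_p_group :: "nat \<Rightarrow> ('a, 'b) monoid_scheme \<Rightarrow> bool" where
  "finite_p_group p G \<longleftrightarrow> group G \<and> finite (carrier G) \<and> (\<exists>n. order G = p ^ n)"

text \<open>
  The commutator convention \<open>x y x\<inverse> y\<inverse>\<close> is the one of the library's \<open>derived_set\<close>. For
  subgroups \<open>H\<close> and \<open>K\<close>, the convention \<open>x\<inverse> y\<inverse> x y\<close> yields the same set of commutators.
\<close>
definition commutator_subgroup ::
  "('a, 'b) monoid_scheme \<Rightarrow> 'a set \<Rightarrow> 'a set \<Rightarrow> 'a set" where
  "commutator_subgroup G H K =
     generate G {x \<otimes>\<^bsub>G\<^esub> y \<otimes>\<^bsub>G\<^esub> inv\<^bsub>G\<^esub> x \<otimes>\<^bsub>G\<^esub> inv\<^bsub>G\<^esub> y | x y. x \<in> H \<and> y \<in> K}"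

text \<open>The series is indexed from 1; the value at 0 is a dummy.\<close>
fun lower_central :: "('a, 'b) monoid_scheme \<Rightarrow> nat \<Rightarrow> 'a set" where
  "lower_central G 0 = carrier G"
| "lower_central G (Suc 0) = carrier G"
| "lower_central G (Suc (Suc k)) =
     commutator_subgroup G (lower_central G (Suc k)) (carrier G)"

definition power_subgroup :: "('a, 'b) monoid_scheme \<Rightarrow> nat \<Rightarrow> 'a set" where
  "power_subgroup G m = generate G {x [^]\<^bsub>G\<^esub> m | x. x \<in> carrier G}"

definition Omega_set :: "('a, 'b) monoid_scheme \<Rightarrow> nat \<Rightarrow> nat \<Rightarrow> 'a set" where
  "Omega_set G p i = {x \<in> carrier G. x [^]\<^bsub>G\<^esub> (p ^ i) = \<one>\<^bsub>G\<^esub>}"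

definition subgroup_index :: "('a, 'b) monoid_scheme \<Rightarrow> 'a set \<Rightarrow> nat" where
  "subgroup_index G H = card (rcosets\<^bsub>G\<^esub> H)"

end

theory Submission
  imports Defs
begin

text \<open>
  Write \<open>q = p\<^sup>i\<close>, let \<open>F(H) = H\<^sup>q \<gamma>\<^sub>k(H)\<close> and let \<open>\<Omega>(M)\<close> be the set of \<open>x \<in> G\<close> with \<open>x\<^sup>q \<in> M\<close>, so that
  condition (2) says \<open>|F(G)| |\<Omega>(1)| = |G|\<close>. Everything rests on one regularity statement: if the
  subgroup generated by \<open>a\<close> and \<open>x\<close> has small class modulo \<open>L\<close>, then \<open>x\<^sup>q \<in> L\<close> if and only if
  \<open>(a x)\<^sup>q \<in> a\<^sup>q L\<close>. It follows from the Hall-Petrescu formula, which comes from the fact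
  that polynomial sequences with respect to a filtration form a group (Leibman).

  If \<open>C\<close> is normal in \<open>G\<close> and \<open>[C, G, \<dots>, G] \<le> C\<^sup>q\<close> with \<open>k\<close> factors \<open>G\<close>, then \<open>|\<Omega>(M)| / |M|\<close> is the
  same for all normal \<open>M \<le> C\<^sup>q\<close>: one climbs from \<open>M\<close> to a larger \<open>M'\<close> by multiplying with powers
  of an element \<open>u\<close> for which \<open>(u\<^sup>j x)\<^sup>q \<equiv> u\<^sup>j\<^sup>q x\<^sup>q\<close> modulo \<open>M\<close>. With \<open>C = G\<close> this shows
  that (1) implies (2).

  For the converse, \<open>|F(G)| |\<Omega>(1)| \<ge> |G|\<close> holds for every \<open>G\<close>, by induction on \<open>|G|\<close>. If \<open>F(G)\<close> is central
  then \<open>G\<close> is regular. Otherwise let \<open>[F(G), G] / L\<close> be a chief factor of \<open>G\<close>. Commutators give a pairing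
  of \<open>F(G)\<close> and \<open>G\<close> into it with left kernel \<open>Z\<close> and right kernel \<open>C\<close>, so that \<open>|G : C| = |F(G) : Z|\<close>,
  and \<open>F(C) \<le> Z\<close> by regularity, as in Laffey's theorem on \<open>d\<close>-maximal p-groups. Hence the bound for
  \<open>C\<close> gives that for \<open>G\<close>. In the case of equality \<open>Z = C\<^sup>q\<close>, and
  comparing \<open>\<Omega>(1)\<close> with \<open>\<Omega>(Z)\<close> yields \<open>F(G) = G\<^sup>q\<close>.
\<close>

section \<open>Groups as a type class\<close>

text \<open>Groups without a carrier set: subgroups become plain sets, and identities between group
  words hold without membership hypotheses.\<close>

class mgroup = monoid_mult + inverse +
  assumes left_inv: "inverse a * a = 1"
begin

lemma right_inv: "a * inverse a = 1"
  by (metis left_inv mult.assoc mult_1_left)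

lemma left_inv_cancel: "inverse a * (a * b) = b"
  by (metis left_inv mult.assoc mult_1_left)

lemma right_inv_cancel: "a * (inverse a * b) = b"
  by (metis right_inv mult.assoc mult_1_left)

lemma inv_inv: "inverse (inverse a) = a"
  by (metis left_inv_cancel left_inv mult_1_right)

lemma inv_one: "inverse 1 = 1"
  by (metis left_inv mult_1_right)

lemma inv_mult: "inverse (a * b) = inverse b * inverse a"
  by (metis left_inv_cancel left_inv mult.assoc mult_1_right)

text \<open>The complete rewriting system for free groups, so \<open>simp\<close> proves every
  identity between group words.\<close>

lemmas word_simps = mult.assoc left_inv right_inv left_inv_cancel right_inv_cancel
  inv_inv inv_one inv_mult mult_1_left mult_1_right

lemma inv_pow: "inverse a ^ n = inverse (a ^ n)"
  by (induction n) (simp_all add: inv_one inv_mult[symmetric] power_commutes)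

lemma conj_pow: "(inverse g * x * g) ^ n = inverse g * x ^ n * g"
  by (induction n) (simp_all add: word_simps)

lemma inv_mult_eq_iff: "inverse a * b = c \<longleftrightarrow> b = a * c"
  by (metis left_inv_cancel right_inv_cancel)

definition comm :: "'a \<Rightarrow> 'a \<Rightarrow> 'a" where
  "comm x y = inverse x * inverse y * x * y"

definition subgrp :: "'a set \<Rightarrow> bool" where
  "subgrp H \<longleftrightarrow> 1 \<in> H \<and> (\<forall>x\<in>H. \<forall>y\<in>H. x * y \<in> H) \<and> (\<forall>x\<in>H. inverse x \<in> H)"

definition gen :: "'a set \<Rightarrow> 'a set" where
  "gen S = \<Inter>{H. subgrp H \<and> S \<subseteq> H}"

definition normal_in :: "'a set \<Rightarrow> 'a set \<Rightarrow> bool" where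
  "normal_in N G \<longleftrightarrow> subgrp N \<and> N \<subseteq> G \<and> (\<forall>n\<in>N. \<forall>g\<in>G. inverse g * n * g \<in> N)"

definition csub :: "'a set \<Rightarrow> 'a set \<Rightarrow> 'a set" where
  "csub A B = gen {comm a b | a b. a \<in> A \<and> b \<in> B}"

definition sprod :: "'a set \<Rightarrow> 'a set \<Rightarrow> 'a set" where
  "sprod A B = {a * b | a b. a \<in> A \<and> b \<in> B}"

text \<open>\<open>lcs N G m\<close> has \<open>m\<close> factors \<open>G\<close>, so \<open>lcs G G m\<close> is \<open>\<gamma>\<close> with index \<open>m + 1\<close>.\<close>
primrec lcs :: "'a set \<Rightarrow> 'a set \<Rightarrow> nat \<Rightarrow> 'a set" where
  "lcs N G 0 = N"
| "lcs N G (Suc m) = csub (lcs N G m) G"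

definition pow_sub :: "'a set \<Rightarrow> nat \<Rightarrow> 'a set" where
  "pow_sub N q = gen {x ^ q | x. x \<in> N}"

definition roots :: "'a set \<Rightarrow> nat \<Rightarrow> 'a set \<Rightarrow> 'a set" where
  "roots G q M = {x \<in> G. x ^ q \<in> M}"

section \<open>Subgroups, generated subgroups and normality\<close>

lemma subgrp_one: "subgrp H \<Longrightarrow> 1 \<in> H"
  and subgrp_mult: "subgrp H \<Longrightarrow> x \<in> H \<Longrightarrow> y \<in> H \<Longrightarrow> x * y \<in> H"
  and subgrp_inv: "subgrp H \<Longrightarrow> x \<in> H \<Longrightarrow> inverse x \<in> H"
  by (simp_all add: subgrp_def)

lemma subgrp_pow: "subgrp H \<Longrightarrow> x \<in> H \<Longrightarrow> x ^ n \<in> H"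
  by (induction n) (simp_all add: subgrp_def)

lemmas subgrp_closed = subgrp_one subgrp_mult subgrp_inv subgrp_pow

lemma subgrp_inv_iff: "subgrp H \<Longrightarrow> inverse x \<in> H \<longleftrightarrow> x \<in> H"
  by (metis inv_inv subgrp_inv)

lemma subgrp_mult_left_iff: "subgrp H \<Longrightarrow> x \<in> H \<Longrightarrow> x * y \<in> H \<longleftrightarrow> y \<in> H"
  by (metis left_inv_cancel subgrp_inv subgrp_mult)

lemma subgrp_mult_right_iff: "subgrp H \<Longrightarrow> y \<in> H \<Longrightarrow> x * y \<in> H \<longleftrightarrow> x \<in> H"
  by (metis mult.assoc mult_1_right right_inv subgrp_inv subgrp_mult)

lemma subgrp_comm: "subgrp H \<Longrightarrow> x \<in> H \<Longrightarrow> y \<in> H \<Longrightarrow> comm x y \<in> H"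
  by (simp add: comm_def subgrp_closed)

lemma subgrp_trivial: "subgrp {1}"
  by (simp add: subgrp_def inv_one)

lemma subgrp_Int: "subgrp H \<Longrightarrow> subgrp K \<Longrightarrow> subgrp (H \<inter> K)"
  by (auto simp: subgrp_def)

lemma subgrp_gen: "subgrp (gen S)"
  by (auto simp: gen_def subgrp_def)

lemma gen_incl: "x \<in> S \<Longrightarrow> x \<in> gen S"
  by (auto simp: gen_def)

lemma gen_least: "subgrp H \<Longrightarrow> S \<subseteq> H \<Longrightarrow> gen S \<subseteq> H"
  by (auto simp: gen_def)

lemma normal_in_subgrp: "normal_in N G \<Longrightarrow> subgrp N"
  and normal_in_subset: "normal_in N G \<Longrightarrow> N \<subseteq> G"
  and normal_in_conj: "normal_in N G \<Longrightarrow> n \<in> N \<Longrightarrow> g \<in> G \<Longrightarrow> inverse g * n * g \<in> N"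
  by (auto simp: normal_in_def)

lemma normal_in_conj':
  assumes "subgrp G" "normal_in N G" "n \<in> N" "g \<in> G"
  shows "g * n * inverse g \<in> N"
  using normal_in_conj[OF assms(2,3) subgrp_inv[OF assms(1,4)]] by (simp add: inv_inv)

lemma normal_in_conj_iff:
  assumes "subgrp G" "normal_in N G" "g \<in> G"
  shows "inverse g * n * g \<in> N \<longleftrightarrow> n \<in> N"
proof
  assume "inverse g * n * g \<in> N"
  from normal_in_conj'[OF assms(1,2) this assms(3)] show "n \<in> N" by (simp add: word_simps)
qed (use assms normal_in_conj in blast)

lemma normal_in_swap:
  assumes "subgrp G" "normal_in N G" "b \<in> G" "a * b \<in> N"
  shows "b * a \<in> N"
  using normal_in_conj'[OF assms(1,2) assms(4) assms(3)] by (simp add: word_simps)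

lemma normal_in_self: "subgrp G \<Longrightarrow> normal_in G G"
  by (simp add: normal_in_def subgrp_closed)

lemma normal_in_trivial: "subgrp G \<Longrightarrow> normal_in {1} G"
  by (simp add: normal_in_def subgrp_trivial subgrp_one word_simps)

text \<open>The elements of \<open>G\<close> all of whose conjugates lie in \<open>gen S\<close>
  form a subgroup; it contains \<open>S\<close>, hence \<open>gen S\<close>.\<close>

lemma normal_in_gen:
  assumes G: "subgrp G" and S: "S \<subseteq> G"
    and conj: "\<And>s g. s \<in> S \<Longrightarrow> g \<in> G \<Longrightarrow> inverse g * s * g \<in> gen S"
  shows "normal_in (gen S) G"
proof -
  let ?H = "{n \<in> G. \<forall>g\<in>G. inverse g * n * g \<in> gen S}"
  have "subgrp ?H"
    unfolding subgrp_def
  proof (intro conjI ballI)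
    show "1 \<in> ?H" using G subgrp_gen[of S] by (simp add: subgrp_one word_simps)
  next
    fix x y assume xy: "x \<in> ?H" "y \<in> ?H"
    have "inverse g * (x * y) * g \<in> gen S" if "g \<in> G" for g
    proof -
      have "(inverse g * x * g) * (inverse g * y * g) \<in> gen S"
        using xy that subgrp_gen[of S] by (blast intro: subgrp_mult)
      then show ?thesis by (simp add: word_simps)
    qed
    then show "x * y \<in> ?H" using xy G by (simp add: subgrp_mult)
  next
    fix x assume x: "x \<in> ?H"
    have "inverse g * inverse x * g \<in> gen S" if "g \<in> G" for g
    proof -
      have "inverse (inverse g * x * g) \<in> gen S"
        using x that subgrp_gen[of S] by (blast intro: subgrp_inv)
      then show ?thesis by (simp add: word_simps)
    qed
    then show "inverse x \<in> ?H" using x G by (simp add: subgrp_inv)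
  qed
  then have "gen S \<subseteq> ?H"
    using S conj by (intro gen_least) auto
  then show ?thesis by (auto simp: normal_in_def subgrp_gen)
qed

section \<open>Commutator identities and the three subgroups lemma\<close>

lemma conj_comm: "inverse g * comm a b * g = comm (inverse g * a * g) (inverse g * b * g)"
  by (simp add: comm_def word_simps)

lemma comm_mult_left: "comm (x * y) z = (inverse y * comm x z * y) * comm y z"
  by (simp add: comm_def word_simps)

lemma comm_inv_left: "comm (inverse x) z = x * inverse (comm x z) * inverse x"
  by (simp add: comm_def word_simps)

lemma comm_inv: "inverse (comm x y) = comm y x"
  by (simp add: comm_def word_simps)

lemma comm_one: "comm 1 x = 1" "comm x 1 = 1"
  by (simp_all add: comm_def word_simps)

lemma conj_eq_comm: "inverse g * x * g = x * comm x g"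
  by (simp add: comm_def word_simps)

lemma comm_in_swap: "subgrp T \<Longrightarrow> comm a b \<in> T \<longleftrightarrow> comm b a \<in> T"
  by (metis comm_inv subgrp_inv)

lemma comm_in_normal: "subgrp G \<Longrightarrow> normal_in N G \<Longrightarrow> n \<in> N \<Longrightarrow> g \<in> G \<Longrightarrow> comm n g \<in> N"
  using normal_in_conj[of N G n g] normal_in_subgrp[of N G]
  by (metis comm_def mult.assoc subgrp_inv subgrp_mult)

lemma normal_in_csub:
  assumes G: "subgrp G" and "normal_in A G" "normal_in B G"
  shows "normal_in (csub A B) G"
  unfolding csub_def
proof (rule normal_in_gen[OF G])
  have "A \<subseteq> G" "B \<subseteq> G" using assms normal_in_subset by auto
  then show "{comm a b |a b. a \<in> A \<and> b \<in> B} \<subseteq> G" using G subgrp_comm by blast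
next
  fix s g assume "s \<in> {comm a b |a b. a \<in> A \<and> b \<in> B}" and g: "g \<in> G"
  then obtain a b where s: "s = comm a b" "a \<in> A" "b \<in> B" by auto
  then have "inverse g * a * g \<in> A" "inverse g * b * g \<in> B" using assms g normal_in_conj by auto
  then show "inverse g * s * g \<in> gen {comm a b |a b. a \<in> A \<and> b \<in> B}"
    unfolding s(1) conj_comm by (intro gen_incl) blast
qed

lemma comm_in_csub: "a \<in> A \<Longrightarrow> b \<in> B \<Longrightarrow> comm a b \<in> csub A B"
  unfolding csub_def by (intro gen_incl) blast

lemma subgrp_csub: "subgrp (csub A B)"
  by (simp add: csub_def subgrp_gen)

lemma csub_least:
  "subgrp T \<Longrightarrow> (\<And>a b. a \<in> A \<Longrightarrow> b \<in> B \<Longrightarrow> comm a b \<in> T) \<Longrightarrow> csub A B \<subseteq> T"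
  unfolding csub_def by (intro gen_least) auto

lemma csub_mono: "A \<subseteq> A' \<Longrightarrow> B \<subseteq> B' \<Longrightarrow> csub A B \<subseteq> csub A' B'"
  by (intro csub_least subgrp_csub) (auto intro: comm_in_csub)

lemma csub_commute: "csub A B = csub B A"
proof -
  have "csub A B \<subseteq> csub B A" for A B
    by (intro csub_least subgrp_csub) (metis comm_in_csub comm_in_swap subgrp_csub)
  then show ?thesis by blast
qed

lemma csub_normal_subset: "subgrp G \<Longrightarrow> normal_in A G \<Longrightarrow> B \<subseteq> G \<Longrightarrow> csub A B \<subseteq> A"
  by (intro csub_least) (auto intro: comm_in_normal normal_in_subgrp)

text \<open>Together with \<open>gen_least\<close> this reduces inclusions of commutator subgroups
  in a normal \<open>T\<close> to generators.\<close>

lemma subgrp_comm_set: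
  assumes G: "subgrp G" and T: "normal_in T G" and B: "B \<subseteq> G"
  shows "subgrp {x \<in> G. \<forall>b\<in>B. comm x b \<in> T}"
  unfolding subgrp_def
proof (intro conjI ballI)
  show "1 \<in> {x \<in> G. \<forall>b\<in>B. comm x b \<in> T}"
    using G T by (simp add: subgrp_one comm_one normal_in_subgrp)
next
  fix x y assume xy: "x \<in> {x \<in> G. \<forall>b\<in>B. comm x b \<in> T}" "y \<in> {x \<in> G. \<forall>b\<in>B. comm x b \<in> T}"
  then show "x * y \<in> {x \<in> G. \<forall>b\<in>B. comm x b \<in> T}"
    using G T by (auto simp: comm_mult_left intro!: subgrp_mult normal_in_subgrp[OF T] normal_in_conj[OF T])
next
  fix x assume x: "x \<in> {x \<in> G. \<forall>b\<in>B. comm x b \<in> T}"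
  then show "inverse x \<in> {x \<in> G. \<forall>b\<in>B. comm x b \<in> T}"
    using G T by (auto simp: comm_inv_left intro!: subgrp_inv normal_in_subgrp[OF T] normal_in_conj'[OF G T])
qed

lemma csub_gen_left:
  assumes "subgrp G" "normal_in T G" "B \<subseteq> G" "S \<subseteq> G"
    and "\<And>s b. s \<in> S \<Longrightarrow> b \<in> B \<Longrightarrow> comm s b \<in> T"
  shows "csub (gen S) B \<subseteq> T"
proof -
  have "gen S \<subseteq> {x \<in> G. \<forall>b\<in>B. comm x b \<in> T}"
    using assms by (intro gen_least subgrp_comm_set) auto
  then show ?thesis using assms normal_in_subgrp by (intro csub_least) auto
qed

lemma hall_witt:
  "(inverse y * comm (comm x (inverse y)) z * y) * (inverse z * comm (comm y (inverse z)) x * z)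
    * (inverse x * comm (comm z (inverse x)) y * x) = 1"
  by (simp add: comm_def word_simps)

text \<open>Two of the three factors in the Hall-Witt identity lie in \<open>T\<close>, hence so
  does the third.\<close>

lemma three_subgroups:
  assumes G: "subgrp G" and "normal_in A G" "normal_in B G" "normal_in C G" and T: "normal_in T G"
    and AB: "csub (csub A B) C \<subseteq> T" and BC: "csub (csub B C) A \<subseteq> T"
  shows "csub (csub C A) B \<subseteq> T"
  unfolding csub_def[of C A]
proof (rule csub_gen_left[OF G T])
  have sub: "A \<subseteq> G" "B \<subseteq> G" "C \<subseteq> G" and sg: "subgrp A" "subgrp B" "subgrp C"
    using assms normal_in_subset normal_in_subgrp by auto
  then show "B \<subseteq> G" "{comm a b |a b. a \<in> C \<and> b \<in> A} \<subseteq> G" using G subgrp_comm by blast+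
  fix s y assume "s \<in> {comm a b |a b. a \<in> C \<and> b \<in> A}" and y: "y \<in> B"
  then obtain z a where s: "s = comm z a" "z \<in> C" "a \<in> A" by auto
  \<comment> \<open>The Hall-Witt identity contains \<open>comm z (inverse x)\<close>, which becomes
    the given generator for this \<open>x\<close>.\<close>
  define x where "x = inverse a"
  have x: "x \<in> A" "s = comm z (inverse x)" using s sg by (auto simp: x_def inv_inv subgrp_inv)
  have "comm (comm x (inverse y)) z \<in> T"
    using AB x y s sg by (intro subsetD[OF AB] comm_in_csub subgrp_inv) auto
  then have 1: "inverse y * comm (comm x (inverse y)) z * y \<in> T"
    using y sub T normal_in_conj by blast
  have "comm (comm y (inverse z)) x \<in> T"
    using x y s sg by (intro subsetD[OF BC] comm_in_csub subgrp_inv) auto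
  then have 2: "inverse z * comm (comm y (inverse z)) x * z \<in> T"
    using s sub T normal_in_conj by blast
  have "inverse x * comm (comm z (inverse x)) y * x \<in> T"
    using hall_witt[of y x z] subgrp_mult_left_iff[OF normal_in_subgrp[OF T] subgrp_mult[OF normal_in_subgrp[OF T] 1 2]]
      subgrp_one[OF normal_in_subgrp[OF T]] by metis
  then show "comm s y \<in> T"
    using normal_in_conj_iff[OF G T] x sub by blast
qed

section \<open>Iterated commutator subgroups\<close>

lemma normal_in_lcs:
  "subgrp G \<Longrightarrow> normal_in N G \<Longrightarrow> normal_in H G \<Longrightarrow> normal_in (lcs N H m) G"
  by (induction m) (simp_all add: normal_in_csub)

lemma lcs_Suc_subset: "subgrp G \<Longrightarrow> normal_in N G \<Longrightarrow> normal_in H G \<Longrightarrow> lcs N H (Suc m) \<subseteq> lcs N H m"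
  using csub_normal_subset[OF _ normal_in_lcs] normal_in_subset by simp

lemma lcs_antimono:
  assumes "subgrp G" "normal_in N G" "normal_in H G" "m \<le> n"
  shows "lcs N H n \<subseteq> lcs N H m"
  using lift_Suc_antimono_le[of "lcs N H", OF _ assms(4)] lcs_Suc_subset[OF assms(1-3)] by simp

lemma lcs_mono: "A \<subseteq> A' \<Longrightarrow> B \<subseteq> B' \<Longrightarrow> lcs A B m \<subseteq> lcs A' B' m"
  by (induction m) (simp_all add: csub_mono)

lemma lcs_add: "lcs N H (m + n) = lcs (lcs N H m) H n"
  by (induction n) simp_all

text \<open>The three subgroups lemma moves one factor \<open>H\<close> from the second entry to the
  first, so the induction on \<open>n\<close> needs arbitrary \<open>m\<close>.\<close>

lemma csub_lcs_lcs:
  assumes G: "subgrp G" and N: "normal_in N G" and H: "normal_in H G"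
  shows "csub (lcs N H m) (lcs H H n) \<subseteq> lcs N H (m + n + 1)"
proof (induction n arbitrary: m)
  case (Suc n)
  note nrm = normal_in_lcs[OF G N H] normal_in_lcs[OF G H H]
  have "csub (csub (lcs H H n) H) (lcs N H m) \<subseteq> lcs N H (m + Suc n + 1)"
  proof (rule three_subgroups[OF G H nrm(1) nrm(2) nrm(1)])
    have "csub (csub H (lcs N H m)) (lcs H H n) = csub (lcs N H (Suc m)) (lcs H H n)"
      by (simp add: csub_commute)
    also have "\<dots> \<subseteq> lcs N H (m + Suc n + 1)" using Suc[of "Suc m"] by simp
    finally show "csub (csub H (lcs N H m)) (lcs H H n) \<subseteq> lcs N H (m + Suc n + 1)" .
    have "csub (csub (lcs N H m) (lcs H H n)) H \<subseteq> csub (lcs N H (m + n + 1)) H"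
      using Suc by (intro csub_mono) auto
    then show "csub (csub (lcs N H m) (lcs H H n)) H \<subseteq> lcs N H (m + Suc n + 1)" by simp
  qed
  then show ?case by (metis csub_commute lcs.simps(2))
qed simp

lemma csub_lcs_lcs':
  assumes G: "subgrp G" and N: "normal_in N G"
  shows "csub (lcs N G m) (lcs N G n) \<subseteq> lcs N G (m + n + 1)"
proof -
  have "csub (lcs N G m) (lcs N G n) \<subseteq> csub (lcs N G m) (lcs G G n)"
    using lcs_mono[of N G G G] normal_in_subset[OF N] by (intro csub_mono) auto
  also have "\<dots> \<subseteq> lcs N G (m + n + 1)" by (rule csub_lcs_lcs[OF G N normal_in_self[OF G]])
  finally show ?thesis .
qed

lemma sprodI: "a \<in> A \<Longrightarrow> b \<in> B \<Longrightarrow> a * b \<in> sprod A B"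
  by (auto simp: sprod_def)

section \<open>Products of subgroups and power subgroups\<close>

lemma subgrp_sprod:
  assumes G: "subgrp G" and A: "subgrp A" "A \<subseteq> G" and B: "normal_in B G"
  shows "subgrp (sprod A B)"
  unfolding subgrp_def
proof (intro conjI ballI)
  note sB = normal_in_subgrp[OF B]
  show "1 \<in> sprod A B" using sprodI[of 1 A 1 B] A sB by (simp add: subgrp_one)
  fix x assume "x \<in> sprod A B"
  then obtain a b where x: "x = a * b" "a \<in> A" "b \<in> B" by (auto simp: sprod_def)
  have "inverse x = inverse a * (a * inverse b * inverse a)" by (simp add: x word_simps)
  moreover have "a * inverse b * inverse a \<in> B"
    using normal_in_conj'[OF G B subgrp_inv[OF sB x(3)]] x A by auto
  ultimately show "inverse x \<in> sprod A B" using A(1) x(2) by (simp add: sprodI subgrp_inv)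
  fix y assume "y \<in> sprod A B"
  then obtain c d where y: "y = c * d" "c \<in> A" "d \<in> B" by (auto simp: sprod_def)
  have "x * y = (a * c) * ((inverse c * b * c) * d)" by (simp add: x y word_simps)
  moreover have "(inverse c * b * c) * d \<in> B"
    using y x A by (intro subgrp_mult[OF sB] normal_in_conj[OF B]) auto
  ultimately show "x * y \<in> sprod A B" using A x y subgrp_mult[of A a c] unfolding sprod_def by blast
qed

lemma sprod_incl:
  assumes "subgrp A" "subgrp B"
  shows "A \<subseteq> sprod A B" "B \<subseteq> sprod A B"
  using sprodI[of _ A 1 B] sprodI[of 1 A _ B] assms by (auto simp: subgrp_one)

lemma sprod_least: "subgrp H \<Longrightarrow> A \<subseteq> H \<Longrightarrow> B \<subseteq> H \<Longrightarrow> sprod A B \<subseteq> H"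
  by (auto simp: sprod_def subset_iff subgrp_mult)

lemma normal_in_sprod:
  assumes G: "subgrp G" and A: "normal_in A G" and B: "normal_in B G"
  shows "normal_in (sprod A B) G"
  unfolding normal_in_def
proof (intro conjI ballI)
  show "subgrp (sprod A B)" using subgrp_sprod[OF G] A B by (simp add: normal_in_def)
  show "sprod A B \<subseteq> G" using sprod_least[OF G] A B by (simp add: normal_in_def)
  fix n g assume "n \<in> sprod A B" and g: "g \<in> G"
  then obtain a b where n: "n = a * b" "a \<in> A" "b \<in> B" by (auto simp: sprod_def)
  have "inverse g * n * g = (inverse g * a * g) * (inverse g * b * g)" by (simp add: n word_simps)
  then show "inverse g * n * g \<in> sprod A B"
    using normal_in_conj[OF A n(2) g] normal_in_conj[OF B n(3) g] unfolding sprod_def by blast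
qed

lemma csub_sprod_left:
  assumes G: "subgrp G" and A: "A \<subseteq> G" and B: "B \<subseteq> G" and C: "C \<subseteq> G" and T: "normal_in T G"
    and "csub A C \<subseteq> T" "csub B C \<subseteq> T"
  shows "csub (sprod A B) C \<subseteq> T"
proof -
  have "sprod A B \<subseteq> {x \<in> G. \<forall>c\<in>C. comm x c \<in> T}"
    using assms comm_in_csub by (intro sprod_least subgrp_comm_set) blast+
  then show ?thesis using T normal_in_subgrp by (intro csub_least) auto
qed

lemma pow_in_pow_sub: "x \<in> N \<Longrightarrow> x ^ q \<in> pow_sub N q"
  unfolding pow_sub_def by (intro gen_incl) blast

lemma subgrp_pow_sub: "subgrp (pow_sub N q)"
  by (simp add: pow_sub_def subgrp_gen)

lemma pow_sub_least: "subgrp H \<Longrightarrow> (\<And>x. x \<in> N \<Longrightarrow> x ^ q \<in> H) \<Longrightarrow> pow_sub N q \<subseteq> H"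
  unfolding pow_sub_def by (intro gen_least) auto

lemma pow_sub_mono: "A \<subseteq> B \<Longrightarrow> pow_sub A q \<subseteq> pow_sub B q"
  by (intro pow_sub_least subgrp_pow_sub) (auto intro: pow_in_pow_sub)

lemma pow_sub_subset: "subgrp N \<Longrightarrow> pow_sub N q \<subseteq> N"
  by (intro pow_sub_least) (auto intro: subgrp_pow)

lemma normal_in_pow_sub:
  assumes G: "subgrp G" and N: "normal_in N G"
  shows "normal_in (pow_sub N q) G"
  unfolding pow_sub_def
proof (rule normal_in_gen[OF G])
  show "{x ^ q |x. x \<in> N} \<subseteq> G" using N by (auto simp: normal_in_def subset_iff subgrp_pow)
  fix s g assume "s \<in> {x ^ q |x. x \<in> N}" and g: "g \<in> G"
  then obtain x where "s = x ^ q" "x \<in> N" by auto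
  then show "inverse g * s * g \<in> gen {x ^ q |x. x \<in> N}"
    using normal_in_conj[OF N _ g] by (intro gen_incl) (auto simp: conj_pow[symmetric])
qed

end

section \<open>Polynomial sequences\<close>

context mgroup
begin

text \<open>The index is a commutator weight. \<open>S 0\<close> repeats \<open>S 1\<close>, so that
  a sequence of weight 0 has its values and its first differences in the same group.\<close>

definition filtration :: "(nat \<Rightarrow> 'a set) \<Rightarrow> bool" where
  "filtration S \<longleftrightarrow> S 0 = S 1 \<and> (\<forall>i. subgrp (S i)) \<and> (\<forall>i. S (Suc i) \<subseteq> S i)
     \<and> (\<forall>i j. \<forall>x\<in>S i. \<forall>y\<in>S j. comm x y \<in> S (i + j))"

definition delta :: "(nat \<Rightarrow> 'a) \<Rightarrow> nat \<Rightarrow> 'a" where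
  "delta g n = inverse (g n) * g (Suc n)"

text \<open>Each difference raises the weight by one. Stopping after \<open>m\<close> differences
  provides the induction parameter for Leibman's theorem.\<close>

primrec poly_upto :: "(nat \<Rightarrow> 'a set) \<Rightarrow> nat \<Rightarrow> nat \<Rightarrow> (nat \<Rightarrow> 'a) \<Rightarrow> bool" where
  "poly_upto S 0 k g \<longleftrightarrow> (\<forall>n. g n \<in> S k)"
| "poly_upto S (Suc m) k g \<longleftrightarrow> (\<forall>n. g n \<in> S k) \<and> poly_upto S m (Suc k) (delta g)"

definition poly_seq :: "(nat \<Rightarrow> 'a set) \<Rightarrow> nat \<Rightarrow> (nat \<Rightarrow> 'a) \<Rightarrow> bool" where
  "poly_seq S k g \<longleftrightarrow> (\<forall>m. poly_upto S m k g)"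

lemma filtration_subgrp: "filtration S \<Longrightarrow> subgrp (S i)"
  and filtration_comm: "filtration S \<Longrightarrow> x \<in> S i \<Longrightarrow> y \<in> S j \<Longrightarrow> comm x y \<in> S (i + j)"
  and filtration_zero: "filtration S \<Longrightarrow> S 0 = S (Suc 0)"
  by (simp_all add: filtration_def)

lemma filtration_antimono: "filtration S \<Longrightarrow> i \<le> j \<Longrightarrow> S j \<subseteq> S i"
  by (rule lift_Suc_antimono_le[of S]) (simp_all add: filtration_def)

lemma poly_upto_value: "poly_upto S m k g \<Longrightarrow> g n \<in> S k"
  by (cases m) simp_all

lemma poly_upto_less: "poly_upto S (Suc m) k g \<Longrightarrow> poly_upto S m k g"
  by (induction m arbitrary: k g) auto

lemma poly_upto_antimono:
  assumes "filtration S" "k \<le> l" "poly_upto S m l g"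
  shows "poly_upto S m k g"
  using assms(2,3)
proof (induction m arbitrary: k l g)
  case 0
  then show ?case using filtration_antimono[OF assms(1), of k l] by auto
next
  case (Suc m)
  then show ?case using filtration_antimono[OF assms(1), of k l] Suc.IH[of "Suc k" "Suc l" "delta g"] by auto
qed

lemma delta_mult:
  "delta (\<lambda>n. g n * h n) = (\<lambda>n. delta g n * (comm (delta g n) (h n) * delta h n))"
  by (simp add: fun_eq_iff delta_def comm_def word_simps)

text \<open>Each of the five factors involves \<open>delta g\<close> or \<open>delta h\<close>, so
  each has weight at least one more than the commutator of \<open>g\<close> and
  \<open>h\<close>.\<close>

lemma delta_comm:
  "delta (\<lambda>n. comm (g n) (h n)) = (\<lambda>n.
     comm (g n) (delta h n) * (comm (comm (g n) (delta h n)) (comm (g n) (h n))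
       * (comm (comm (g n) (h n)) (delta h n)
       * (comm (comm (g n) (h n * delta h n)) (delta g n)
       * comm (delta g n) (h n * delta h n)))))"
  by (simp add: fun_eq_iff delta_def comm_def word_simps)

text \<open>Leibman's theorem. The difference of a product contains a commutator and the difference
  of a commutator is a product of commutators, so both closure properties go through one induction
  on \<open>m\<close>.\<close>

lemma poly_upto_mult_comm:
  assumes S: "filtration S"
  shows "(\<forall>k g h. poly_upto S m k g \<longrightarrow> poly_upto S m k h \<longrightarrow> poly_upto S m k (\<lambda>n. g n * h n))
    \<and> (\<forall>i j g h. poly_upto S m i g \<longrightarrow> poly_upto S m j h \<longrightarrow>
          poly_upto S m (i + j) (\<lambda>n. comm (g n) (h n)))"
proof (induction m)
  case 0
  then show ?case using filtration_subgrp[OF S] filtration_comm[OF S] by (auto simp: subgrp_mult)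
next
  case (Suc m)
  have mult: "poly_upto S m k (\<lambda>n. g n * h n)" if "poly_upto S m k g" "poly_upto S m k h" for k g h
    using Suc that by blast
  have comm: "poly_upto S m l (\<lambda>n. comm (g n) (h n))"
    if "poly_upto S m i g" "poly_upto S m j h" "l \<le> i + j" for i j l g h
    using Suc that poly_upto_antimono[OF S] by blast
  show ?case
  proof (intro conjI allI impI)
    fix k g h assume g: "poly_upto S (Suc m) k g" and h: "poly_upto S (Suc m) k h"
    have "poly_upto S m (Suc k) (delta (\<lambda>n. g n * h n))"
      unfolding delta_mult using g h
      by (intro mult comm[of "Suc k" _ k]) (use poly_upto_less[OF h] in auto)
    then show "poly_upto S (Suc m) k (\<lambda>n. g n * h n)"
      using g h filtration_subgrp[OF S] by (auto simp: subgrp_mult)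
  next
    fix i j g h assume g: "poly_upto S (Suc m) i g" and h: "poly_upto S (Suc m) j h"
    have g0: "poly_upto S m i g" and h0: "poly_upto S m j h"
      using g h poly_upto_less by blast+
    have g1: "poly_upto S m (Suc i) (delta g)" and h1: "poly_upto S m (Suc j) (delta h)"
      using g h by auto
    have h2: "poly_upto S m j (\<lambda>n. h n * delta h n)"
      using h0 poly_upto_antimono[OF S _ h1, of j] by (intro mult) auto
    note c = comm[OF g0 h1 order_refl] comm[OF g0 h0 order_refl] comm[OF g0 h2 order_refl]
    have "poly_upto S m (Suc (i + j)) (delta (\<lambda>n. comm (g n) (h n)))"
      unfolding delta_comm
      by (intro mult comm[OF c(1) c(2)] comm[OF c(2) h1] comm[OF c(3) g1] comm[OF g1 h2] comm[OF g0 h1]) auto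
    then show "poly_upto S (Suc m) (i + j) (\<lambda>n. comm (g n) (h n))"
      using g h filtration_comm[OF S] by auto
  qed
qed

lemma poly_seq_mult:
  "filtration S \<Longrightarrow> poly_seq S k g \<Longrightarrow> poly_seq S k h \<Longrightarrow> poly_seq S k (\<lambda>n. g n * h n)"
  using poly_upto_mult_comm unfolding poly_seq_def by blast

lemma poly_seq_delta: "poly_seq S k g \<Longrightarrow> poly_seq S (Suc k) (delta g)"
  unfolding poly_seq_def by (metis poly_upto.simps(2))

text \<open>Pascal's rule. For \<open>j = 0\<close> the difference is the constant 1, written as a
  binomial power so that the same induction applies to it.\<close>

lemma delta_binomial:
  "delta (\<lambda>n. c ^ (n choose j)) = (case j of 0 \<Rightarrow> (\<lambda>n. 1 ^ (n choose 0)) | Suc j' \<Rightarrow> (\<lambda>n. c ^ (n choose j')))"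
  by (auto simp: fun_eq_iff delta_def power_add power_commutes left_inv mult.assoc split: nat.split)
    (metis left_inv_cancel power_add add.commute)

lemma poly_seq_binomial:
  assumes S: "filtration S" and c: "c \<in> S (k + j)"
  shows "poly_seq S k (\<lambda>n. c ^ (n choose j))"
proof -
  have "poly_upto S m k (\<lambda>n. c ^ (n choose j))" for m
    using c
  proof (induction m arbitrary: k j c)
    case 0
    then show ?case using filtration_antimono[OF S, of k "k + j"] filtration_subgrp[OF S] by (auto intro: subgrp_pow)
  next
    case (Suc m)
    have "c ^ (n choose j) \<in> S k" for n
      using Suc.prems filtration_antimono[OF S, of k "k + j"] filtration_subgrp[OF S] by (auto intro: subgrp_pow)
    moreover have "poly_upto S m (Suc k) (delta (\<lambda>n. c ^ (n choose j)))"
    proof (cases j)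
      case 0
      show ?thesis unfolding delta_binomial 0 nat.case
        by (rule Suc.IH) (simp add: subgrp_one filtration_subgrp[OF S])
    next
      case (Suc j')
      show ?thesis unfolding delta_binomial Suc nat.case
        by (rule Suc.IH) (use Suc.prems Suc in simp)
    qed
    ultimately show ?case by simp
  qed
  then show ?thesis by (simp add: poly_seq_def)
qed

lemma poly_seq_power: "filtration S \<Longrightarrow> a \<in> S 1 \<Longrightarrow> poly_seq S 0 (\<lambda>n. a ^ n)"
  using poly_seq_binomial[of S a 0 1] by simp

lemma values_of_delta:
  assumes H: "subgrp H" and g0: "g 0 = 1" and d: "\<And>n. delta g n \<in> H"
  shows "g n \<in> H"
proof (induction n)
  case 0
  then show ?case using g0 H by (simp add: subgrp_one)
next
  case (Suc n)
  have "g (Suc n) = g n * delta g n" by (simp add: delta_def word_simps)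
  then show ?case using Suc d H by (simp add: subgrp_mult)
qed

text \<open>The difference of \<open>g\<close> has weight \<open>k + 1\<close> and one zero fewer. A
  sequence that starts at 1 stays in any subgroup containing its differences.\<close>

lemma poly_seq_vanishing:
  assumes S: "filtration S"
  shows "poly_seq S k g \<Longrightarrow> (\<And>n. n \<le> m \<Longrightarrow> g n = 1) \<Longrightarrow> g n \<in> S (k + Suc m)"
proof (induction m arbitrary: k g n)
  case 0
  have "delta g n \<in> S (Suc k)" for n
    using poly_seq_delta[OF 0(1)] poly_upto_value unfolding poly_seq_def by blast
  then show ?case using values_of_delta[OF filtration_subgrp[OF S], of g "Suc k" n] 0 by simp
next
  case (Suc m)
  have "delta g n \<in> S (Suc k + Suc m)" for n
  proof (rule Suc.IH[OF poly_seq_delta[OF Suc.prems(1)]])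
    show "delta g n = 1" if "n \<le> m" for n using Suc.prems(2)[of n] Suc.prems(2)[of "Suc n"] that
      by (simp add: delta_def inv_one)
  qed
  then show ?case using values_of_delta[OF filtration_subgrp[OF S], of g "k + Suc (Suc m)" n] Suc.prems by simp
qed

end

section \<open>Binomial coefficients, the Hall-Petrescu congruence and regularity\<close>

lemma prime_power_dvd_binomial:
  fixes p :: nat
  assumes "Factorial_Ring.prime p" "0 < j" "j < p"
  shows "p ^ i dvd (p ^ i choose j)"
proof -
  \<comment> \<open>\<open>j\<close> times this coefficient is \<open>p ^ i\<close> times another
    one, and \<open>j\<close> is coprime to \<open>p\<close>.\<close>
  have "p ^ i dvd j * (p ^ i choose j)"
    using times_binomial_minus1_eq[of j "p ^ i"] assms by simp
  moreover have "coprime (p ^ i) j"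
    using assms by (simp add: prime_imp_coprime nat_dvd_not_less coprime_power_left_iff)
  ultimately show ?thesis by (simp add: coprime_dvd_mult_right_iff)
qed

text \<open>The same identity at \<open>j = p\<close>, where cancelling \<open>p\<close> costs one
  factor \<open>p\<close>.\<close>

lemma prime_power_dvd_binomial_prime:
  fixes p :: nat
  assumes "Factorial_Ring.prime p" "0 < i"
  shows "p ^ (i - 1) dvd (p ^ i choose p)"
proof -
  have "p * p ^ (i - 1) dvd p * (p ^ i choose p)"
    using times_binomial_minus1_eq[of p "p ^ i"] assms prime_gt_0_nat[of p]
    by (metis dvd_triv_left power_eq_if not_gr_zero)
  then show ?thesis using assms prime_gt_0_nat[of p] by simp
qed

context mgroup
begin

text \<open>
  The sequence below vanishes at 0 and 1. Newton interpolation writes its value at \<open>q\<close> as a product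
  of powers \<open>c ^ (q choose j)\<close> with \<open>c \<in> S j\<close> and \<open>2 \<le> j \<le> p\<close>, times an element of \<open>S (p + 1)\<close>.
\<close>
lemma power_mult_mod:
  assumes S: "filtration S" and L: "subgrp L" and p: "Factorial_Ring.prime p" and i: "0 < i"
    and S2: "\<And>s. s \<in> S 2 \<Longrightarrow> s ^ (p ^ i) \<in> L"
    and Sp: "\<And>s. s \<in> S p \<Longrightarrow> s ^ (p ^ (i - 1)) \<in> L"
    and Sp1: "S (Suc p) \<subseteq> L"
    and a: "a \<in> S 1" and x: "x \<in> S 1"
  shows "inverse (x ^ (p ^ i)) * inverse (a ^ (p ^ i)) * (a * x) ^ (p ^ i) \<in> L"
proof -
  define q where "q = p ^ i"
  have step: "c ^ (q choose j) \<in> L" if c: "c \<in> S j" and j: "2 \<le> j" "j \<le> p" for c j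
  proof (cases "j = p")
    case True
    then show ?thesis
      using prime_power_dvd_binomial_prime[OF p i] Sp[of c] c subgrp_pow[OF L]
      by (auto simp: q_def dvd_def power_mult)
  next
    case False
    then have "c ^ q \<in> L" "q dvd (q choose j)"
      using filtration_antimono[OF S, of 2 j] prime_power_dvd_binomial[OF p, of j i] S2 c j by (auto simp: q_def)
    then show ?thesis using subgrp_pow[OF L] by (auto simp: dvd_def power_mult)
  qed
  have van: "r q \<in> L" if "d = p - m" "1 \<le> m" "m \<le> p" "poly_seq S 0 r" "\<And>n. n \<le> m \<Longrightarrow> r n = 1" for d m r
    using that
  proof (induction d arbitrary: m r)
    case 0
    then show ?case using poly_seq_vanishing[OF S 0(4), of m q] Sp1 by auto
  next
    case (Suc d)
    define c where "c = r (Suc m)"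
    \<comment> \<open>The new factor is 1 for \<open>n \<le> m\<close> and cancels \<open>c\<close>
      at \<open>Suc m\<close>, so \<open>r'\<close> has one more zero.\<close>
    define r' where "r' = (\<lambda>n. inverse c ^ (n choose Suc m) * r n)"
    have c: "c \<in> S (Suc m)"
      using poly_seq_vanishing[OF S Suc.prems(4), of m "Suc m"] Suc.prems(5) by (simp add: c_def)
    then have "poly_seq S 0 r'"
      unfolding r'_def using filtration_subgrp[OF S]
      by (intro poly_seq_mult[OF S] poly_seq_binomial[OF S] Suc.prems(4)) (auto intro: subgrp_inv)
    moreover have "r' n = 1" if "n \<le> Suc m" for n
      using that Suc.prems(5)[of n] by (cases "n = Suc m") (simp_all add: r'_def c_def left_inv binomial_eq_0)
    ultimately have "r' q \<in> L" using Suc.IH[of "Suc m" r'] Suc.prems(1,2) by simp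
    moreover have "c ^ (q choose Suc m) \<in> L" using step[OF c] Suc.prems(1,2) by simp
    moreover have "r q = c ^ (q choose Suc m) * r' q" by (simp add: r'_def inv_pow right_inv_cancel)
    ultimately show ?case using subgrp_mult[OF L] by simp
  qed
  define h where "h = (\<lambda>n. inverse x ^ n * (inverse a ^ n * (a * x) ^ n))"
  have "poly_seq S 0 h"
    unfolding h_def using a x filtration_subgrp[OF S]
    by (intro poly_seq_mult[OF S] poly_seq_power[OF S]) (auto intro: subgrp_closed)
  moreover have "h n = 1" if "n \<le> 1" for n
    using that by (cases n) (auto simp: h_def word_simps)
  ultimately have "h q \<in> L" using van[of "p - 1" 1 h] prime_ge_1_nat[OF p] by simp
  then show ?thesis by (simp add: h_def q_def inv_pow mult.assoc)
qed


text \<open>Commuting modulo \<open>T\<close> passes from generators to the generated subgroup,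
  first in the left entry and then, after a swap, in the right one.\<close>

lemma gen_pair_comm:
  assumes G: "subgrp G" and T: "normal_in T G" and ax: "a \<in> G" "x \<in> G" and c: "comm a x \<in> T"
  shows "csub (gen {a, x}) (gen {a, x}) \<subseteq> T"
proof -
  have "comm s b \<in> T" if "s \<in> {a, x}" "b \<in> {a, x}" for s b
  proof -
    have "comm a a = 1" "comm x x = 1" by (simp_all add: comm_def word_simps)
    then show ?thesis using that c comm_in_swap[OF normal_in_subgrp[OF T]] subgrp_one[OF normal_in_subgrp[OF T]] by auto
  qed
  then have "csub (gen {a, x}) {a, x} \<subseteq> T"
    using ax by (intro csub_gen_left[OF G T]) auto
  then have "comm s b \<in> T" if "s \<in> {a, x}" "b \<in> gen {a, x}" for s b
    using that comm_in_csub comm_in_swap[OF normal_in_subgrp[OF T]] by blast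
  moreover have "gen {a, x} \<subseteq> G" using ax gen_least[OF G] by simp
  ultimately show ?thesis using ax by (intro csub_gen_left[OF G T]) auto
qed

text \<open>
  A form of regularity modulo \<open>L\<close>. The hypothesis \<open>x \<in> S t\<close> with large \<open>t\<close> makes the subgroup
  generated by \<open>a\<close> and \<open>x\<close> have small class even if \<open>S\<close> is long, and the proof is a downward
  induction on \<open>t\<close>.
\<close>
lemma regular_mod:
  assumes S: "filtration S" and L: "subgrp L" and p: "Factorial_Ring.prime p" and i: "0 < i"
    and nL: "\<And>s l. s \<in> S 1 \<Longrightarrow> l \<in> L \<Longrightarrow> inverse s * l * s \<in> L"
    and t0: "1 \<le> t0" and Sp1: "S (p + t0) \<subseteq> L"
    and Sp: "\<And>s. s \<in> S (p + t0 - 1) \<Longrightarrow> s ^ (p ^ (i - 1)) \<in> L"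
    and "t0 \<le> t" "a \<in> S 1" "x \<in> S t"
  shows "x ^ (p ^ i) \<in> L \<longleftrightarrow> inverse (a ^ (p ^ i)) * (a * x) ^ (p ^ i) \<in> L"
proof -
  define q where "q = p ^ i"
  note sS = filtration_subgrp[OF S]
  have "x ^ q \<in> L \<longleftrightarrow> inverse (a ^ q) * (a * x) ^ q \<in> L"
    if "d = p + t0 - t" "t0 \<le> t" "a \<in> S 1" "x \<in> S t" for d t a x
    using that
  proof (induction d arbitrary: t a x)
    case 0
    \<comment> \<open>\<open>d = 0\<close> means \<open>t \<ge> p + t0\<close>, so \<open>x\<close>
      lies in \<open>L\<close> and both sides of the equivalence hold.\<close>
    then have xL: "x \<in> L" using filtration_antimono[OF S, of "p + t0" t] Sp1 by auto
    have "inverse (a ^ n) * (a * x) ^ n \<in> L" for n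
    proof (induction n)
      case (Suc n)
      have "inverse (a ^ Suc n) * (a * x) ^ Suc n = inverse a * (inverse (a ^ n) * (a * x) ^ n) * a * x"
        unfolding power_Suc2 by (simp add: word_simps)
      then show ?case using subgrp_mult[OF L nL[OF 0(3) Suc] xL] by simp
    qed (simp add: word_simps subgrp_one[OF L])
    then show ?case using xL by (simp add: subgrp_pow[OF L])
  next
    case (Suc d)
    have t: "1 \<le> t" using Suc.prems t0 by simp
    have IH: "y ^ q \<in> L \<longleftrightarrow> inverse (b ^ q) * (b * y) ^ q \<in> L" if "b \<in> S 1" "y \<in> S (Suc t)" for b y
      using Suc.IH[of "Suc t" b y] Suc.prems that by simp
    have S1: "S j \<subseteq> S 1" for j
      using filtration_antimono[OF S, of 1 j] filtration_zero[OF S] by (cases j) auto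
    have x1: "x \<in> S 1" using S1 Suc.prems by blast
    have cS: "comm x a \<in> S (Suc t)" "comm a x \<in> S (Suc t)"
      using filtration_comm[OF S Suc.prems(4,3)] filtration_comm[OF S Suc.prems(3,4)] by simp_all
    \<comment> \<open>The induction hypothesis, applied to two elements of weight
      \<open>t + 1\<close>, makes this set closed under products.\<close>
    define D where "D = {y \<in> S (Suc t). y ^ q \<in> L}"
    have D: "normal_in D (S 1)"
      unfolding normal_in_def
    proof (intro conjI ballI)
      show "subgrp D"
        unfolding subgrp_def
      proof (intro conjI ballI)
        show "1 \<in> D" by (simp add: D_def subgrp_one sS L)
        fix y assume y: "y \<in> D"
        then show "inverse y \<in> D" by (simp add: D_def subgrp_inv sS L inv_pow)
        fix z assume z: "z \<in> D"
        have "inverse (y ^ q) * (y * z) ^ q \<in> L" using IH[of y z] y z S1 by (auto simp: D_def)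
        then show "y * z \<in> D"
          using y z subgrp_mult_left_iff[OF L, of "inverse (y ^ q)"] by (simp add: D_def subgrp_mult sS subgrp_inv L)
      qed
      show "D \<subseteq> S 1" using S1 by (auto simp: D_def)
      fix n g assume n: "n \<in> D" and g: "g \<in> S 1"
      have "inverse g * n * g \<in> S (Suc t)"
        using filtration_comm[OF S _ g, of n "Suc t"] n filtration_antimono[OF S, of "Suc t" "Suc t + 1"] sS
        by (auto simp: conj_eq_comm D_def intro!: subgrp_mult)
      then show "inverse g * n * g \<in> D" using n nL[OF g] by (simp add: D_def conj_pow)
    qed
    \<comment> \<open>Under this condition the derived subgroup of the group generated by
      \<open>a\<close> and \<open>x\<close> lies in \<open>D\<close>, and the Hall-Petrescu
      congruence applies. Each direction then only has to verify the condition.\<close>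
    have core: "inverse (x ^ q) * inverse (a ^ q) * (a * x) ^ q \<in> L" if "comm a x ^ q \<in> L"
    proof -
      define A where "A = gen {a, x}"
      have A: "subgrp A" "A \<subseteq> S 1" "a \<in> A" "x \<in> A"
        using Suc.prems x1 gen_least[of "S 1" "{a, x}"] sS by (auto simp: A_def subgrp_gen intro: gen_incl)
      have AA: "comm u v \<in> D" if "u \<in> A" "v \<in> A" for u v
        using gen_pair_comm[OF sS D Suc.prems(3) x1] cS \<open>comm a x ^ q \<in> L\<close> that comm_in_csub[of u A v A]
        by (auto simp: D_def A_def)
      have DA: "comm y u \<in> D" "comm u y \<in> D" if "y \<in> D" "u \<in> A" for u y
        using comm_in_normal[OF sS D that(1)] that(2) A(2) comm_in_swap[OF normal_in_subgrp[OF D]] by blast+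
      \<comment> \<open>Since \<open>x\<close> has weight \<open>t\<close>, the commutator of
        \<open>a\<close> and \<open>x\<close> has weight \<open>t + 1\<close> in \<open>S\<close>,
        but it gets weight 2 here. This shift puts \<open>T (Suc p)\<close> inside
        \<open>S (p + t)\<close>, hence inside \<open>L\<close>.\<close>
      define T where "T = (\<lambda>j. if j \<le> 1 then A else A \<inter> D \<inter> S (j + t - 1))"
      have TS: "T j \<subseteq> S (j + t - 1)" if "2 \<le> j" for j using that by (auto simp: T_def)
      have "filtration T"
        unfolding filtration_def
      proof (intro conjI allI ballI)
        show "T 0 = T 1" by (simp add: T_def)
        show "subgrp (T j)" for j using A sS normal_in_subgrp[OF D] by (simp add: T_def subgrp_Int)
        show "T (Suc j) \<subseteq> T j" for j
          using filtration_antimono[OF S, of "j + t - 1" "j + t"] by (auto simp: T_def)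
        fix j k u v assume u: "u \<in> T j" and v: "v \<in> T k"
        have uA: "u \<in> A" "v \<in> A" using u v by (auto simp: T_def split: if_splits)
        then have cA: "comm u v \<in> A" by (simp add: subgrp_comm A)
        have "comm u v \<in> S (j + k + t - 1)" if jk: "2 \<le> j + k"
        proof -
          consider "2 \<le> j" "2 \<le> k" | "j \<le> 1" "2 \<le> k" | "2 \<le> j" "k \<le> 1" | "j = 1" "k = 1" using jk by linarith
          then show ?thesis
          proof cases
            case 1
            then have "comm u v \<in> S ((j + t - 1) + (k + t - 1))"
              using filtration_comm[OF S] u v TS by blast
            moreover have "j + k + t - 1 \<le> (j + t - 1) + (k + t - 1)" using 1 t by linarith
            ultimately show ?thesis using filtration_antimono[OF S] by blast
          next
            case 2
            then have "comm u v \<in> S (1 + (k + t - 1))"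
              using filtration_comm[OF S, of u 1] uA A v TS by blast
            moreover have "j + k + t - 1 \<le> 1 + (k + t - 1)" using 2 t by linarith
            ultimately show ?thesis using filtration_antimono[OF S] by blast
          next
            case 3
            then have "comm u v \<in> S ((j + t - 1) + 1)"
              using filtration_comm[OF S, of u _ v 1] uA A u TS by blast
            moreover have "j + k + t - 1 \<le> (j + t - 1) + 1" using 3 t by linarith
            ultimately show ?thesis using filtration_antimono[OF S] by blast
          next
            case 4
            then show ?thesis using AA[OF uA] by (simp add: D_def)
          qed
        qed
        then show "comm u v \<in> T (j + k)" using cA AA[OF uA] by (auto simp: T_def)
      qed
      moreover have "s ^ (p ^ i) \<in> L" if "s \<in> T 2" for s using that by (simp add: T_def D_def q_def)
      moreover have "s ^ (p ^ (i - 1)) \<in> L" if "s \<in> T p" for s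
      proof -
        have "s \<in> S (p + t - 1)" using that TS[of p] prime_ge_2_nat[OF p] by blast
        moreover have "p + t0 - 1 \<le> p + t - 1" using Suc.prems(2) by linarith
        ultimately show ?thesis using Sp filtration_antimono[OF S] by blast
      qed
      moreover have "T (Suc p) \<subseteq> L"
        using TS[of "Suc p"] prime_ge_2_nat[OF p] Sp1 filtration_antimono[OF S, of "p + t0" "p + t"] Suc.prems(2) by auto
      ultimately show ?thesis
        unfolding q_def using A by (intro power_mult_mod[of T]) (auto simp: L p i T_def)
    qed
    show ?case
    proof
      assume xL: "x ^ q \<in> L"
      \<comment> \<open>\<open>x * comm x a\<close> is a conjugate of \<open>x\<close>, so its
        \<open>q\<close>-th power is in \<open>L\<close>, and the induction hypothesis yields the
        condition of \<open>core\<close>.\<close>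
      have "inverse (x ^ q) * (x * comm x a) ^ q = inverse (x ^ q) * (inverse a * x ^ q * a)"
        by (simp add: conj_eq_comm[symmetric] conj_pow)
      also have "\<dots> \<in> L" using nL[OF Suc.prems(3) xL] xL L by (simp add: subgrp_mult subgrp_inv)
      finally have "comm x a ^ q \<in> L" using IH[OF x1 cS(1)] by simp
      then have "inverse (comm x a ^ q) \<in> L" by (rule subgrp_inv[OF L])
      then have "comm a x ^ q \<in> L" by (simp add: inv_pow[symmetric] comm_inv)
      from subgrp_mult[OF L xL core[OF this]] show "inverse (a ^ q) * (a * x) ^ q \<in> L"
        by (simp add: word_simps)
    next
      assume l: "inverse (a ^ q) * (a * x) ^ q \<in> L"
      define b l where "b = a * x" and "l = inverse (a ^ q) * (a * x) ^ q"
      have aq: "a ^ q = b ^ q * inverse l" by (simp add: l_def b_def word_simps)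
      \<comment> \<open>The induction hypothesis is used for \<open>a\<close> and
        \<open>comm a x\<close>: the element in question is the commutator of \<open>a ^ q\<close>
        and \<open>b\<close>, and modulo \<open>L\<close> the power \<open>a ^ q\<close> is
        \<open>b ^ q\<close>, which commutes with \<open>b\<close>.\<close>
      have "inverse b * a * b = a * comm a x" by (simp add: b_def comm_def word_simps)
      then have "inverse (a ^ q) * (a * comm a x) ^ q = inverse (a ^ q) * (inverse b * a ^ q * b)"
        by (metis conj_pow)
      also have "\<dots> = l * (inverse (b ^ q) * (inverse b * b ^ q) * (inverse l * b))"
        unfolding aq by (simp add: word_simps)
      also have "inverse (b ^ q) * (inverse b * b ^ q) = inverse b"
        by (metis inv_mult inv_mult_eq_iff mult.assoc mult_1_right power_commutes right_inv)
      also have "l * (inverse b * (inverse l * b)) \<in> L"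
        using nL[of b "inverse l"] l Suc.prems(3) x1 sS L
        by (simp add: l_def[symmetric] b_def mult.assoc subgrp_mult subgrp_inv)
      finally have "comm a x ^ q \<in> L" using IH[OF Suc.prems(3) cS(2)] by simp
      from core[OF this] have "inverse (x ^ q) * l \<in> L" by (simp add: l_def mult.assoc)
      then show "x ^ q \<in> L"
        using subgrp_mult_right_iff[OF L, of l "inverse (x ^ q)"] l L by (simp add: l_def subgrp_inv_iff)
    qed
  qed
  then show ?thesis using assms unfolding q_def by blast
qed

end

section \<open>Finite p-groups\<close>

lemma finite_card_le_fibres:
  assumes "finite A" "\<And>x. x \<in> A \<Longrightarrow> card {y \<in> A. f y = f x} \<le> m"
  shows "card A \<le> m * card (f ` A)"
proof -
  have "card A = (\<Sum>y\<in>f ` A. card {x \<in> A. f x = y})"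
    using sum.image_gen[OF assms(1), of "\<lambda>_. 1::nat" f] by simp
  also have "\<dots> \<le> (\<Sum>y\<in>f ` A. m)"
    using assms(2) by (intro sum_mono) auto
  finally show ?thesis by (simp add: mult.commute)
qed

lemma finite_card_eq_fibres:
  assumes "finite A" "\<And>x. x \<in> A \<Longrightarrow> card {y \<in> A. f y = f x} = m"
  shows "card A = m * card (f ` A)"
proof -
  have "card A = (\<Sum>y\<in>f ` A. card {x \<in> A. f x = y})"
    using sum.image_gen[OF assms(1), of "\<lambda>_. 1::nat" f] by simp
  also have "\<dots> = (\<Sum>y\<in>f ` A. m)"
    using assms(2) by (intro sum.cong) auto
  finally show ?thesis by (simp add: mult.commute)
qed

context mgroup
begin

definition lcoset :: "'a \<Rightarrow> 'a set \<Rightarrow> 'a set" where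
  "lcoset x K = (\<lambda>k. x * k) ` K"

definition pgroup :: "nat \<Rightarrow> 'a set \<Rightarrow> bool" where
  "pgroup p G \<longleftrightarrow> subgrp G \<and> finite G \<and> (\<exists>n. card G = p ^ n)"

lemma mem_lcoset: "y \<in> lcoset x K \<longleftrightarrow> inverse x * y \<in> K"
  unfolding lcoset_def by (metis image_iff left_inv_cancel right_inv_cancel)

lemma lcoset_eq_iff:
  assumes "subgrp K"
  shows "lcoset x K = lcoset y K \<longleftrightarrow> inverse x * y \<in> K"
proof
  assume "lcoset x K = lcoset y K"
  moreover have "y \<in> lcoset y K" using assms by (simp add: mem_lcoset left_inv subgrp_one)
  ultimately show "inverse x * y \<in> K" by (metis mem_lcoset)
next
  assume xy: "inverse x * y \<in> K"
  have "inverse x * z \<in> K \<longleftrightarrow> inverse y * z \<in> K" for z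
    using subgrp_mult_left_iff[OF assms xy, of "inverse y * z"] by (simp add: word_simps)
  then show "lcoset x K = lcoset y K" by (auto simp: mem_lcoset)
qed

lemma card_lcoset: "card (lcoset x K) = card K"
  unfolding lcoset_def by (intro card_image inj_onI) (metis left_inv_cancel)

lemma card_eq_cosets:
  assumes "finite G" "subgrp G" "K \<subseteq> G"
    and "\<And>x y. x \<in> G \<Longrightarrow> y \<in> G \<Longrightarrow> f x = f y \<longleftrightarrow> inverse x * y \<in> K"
  shows "card G = card K * card (f ` G)"
proof (rule finite_card_eq_fibres[OF assms(1)])
  fix x assume x: "x \<in> G"
  have "{y \<in> G. f y = f x} = lcoset x K"
    using assms(3,4) x subgrp_mult_left_iff[OF assms(2) subgrp_inv[OF assms(2) x]]
    unfolding set_eq_iff mem_lcoset mem_Collect_eq by (metis subsetD)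
  then show "card {y \<in> G. f y = f x} = card K" by (simp add: card_lcoset)
qed

text \<open>\<open>K\<close> may be any subset of \<open>G\<close>, which allows the set
  \<open>roots G q M\<close>.\<close>

lemma card_le_cosets:
  assumes "finite G" "subgrp G" "K \<subseteq> G"
    and "\<And>x y. x \<in> G \<Longrightarrow> y \<in> G \<Longrightarrow> f x = f y \<Longrightarrow> inverse x * y \<in> K"
  shows "card G \<le> card K * card (f ` G)"
proof (rule finite_card_le_fibres[OF assms(1)])
  fix x assume x: "x \<in> G"
  have "{y \<in> G. f y = f x} \<subseteq> lcoset x K"
    using assms(4) x by (auto simp: mem_lcoset)
  moreover have "finite (lcoset x K)"
    using assms(1,3) finite_subset by (auto simp: lcoset_def)
  ultimately show "card {y \<in> G. f y = f x} \<le> card K" by (metis card_lcoset card_mono)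
qed

lemma card_eq_lcosets:
  assumes "finite G" "subgrp G" "subgrp K" "K \<subseteq> G"
  shows "card G = card K * card ((\<lambda>x. lcoset x K) ` G)"
  using assms lcoset_eq_iff[OF assms(3)] by (intro card_eq_cosets) auto

lemma pow_card_eq_one:
  assumes G: "subgrp G" "finite G" and x: "x \<in> G"
  shows "x ^ card G = 1"
proof -
  \<comment> \<open>A record version of \<open>G\<close>, to which the library's form of Lagrange's
    theorem applies.\<close>
  define A where "A = \<lparr>carrier = G, monoid.mult = (*), one = 1\<rparr>"
  have A: "group A"
  proof (rule groupI)
    show "\<exists>y\<in>carrier A. y \<otimes>\<^bsub>A\<^esub> x = \<one>\<^bsub>A\<^esub>" if "x \<in> carrier A" for x
      using that G subgrp_inv[of G x] by (auto simp: A_def intro!: bexI[of _ "inverse x"] left_inv)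
  qed (use G in \<open>auto simp: A_def subgrp_closed mult.assoc\<close>)
  have "x [^]\<^bsub>A\<^esub> n = x ^ n" for n :: nat
    by (induction n) (simp_all add: A_def nat_pow_def power_Suc2 del: power_Suc)
  then show ?thesis
    using group.pow_order_eq_1[OF A, of x] x by (simp add: A_def order_def)
qed

lemma pgroup_subgrp: "pgroup p G \<Longrightarrow> subgrp G"
  and pgroup_finite: "pgroup p G \<Longrightarrow> finite G"
  by (auto simp: pgroup_def)

lemma pgroup_sub:
  assumes "Factorial_Ring.prime p" "pgroup p G" "subgrp H" "H \<subseteq> G"
  shows "pgroup p H"
proof -
  have "card H dvd card G"
    using card_eq_lcosets[of G H] assms by (simp add: pgroup_def)
  then show ?thesis
    using assms finite_subset divides_primepow_nat unfolding pgroup_def by metis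
qed

lemma pgroup_index:
  assumes p: "Factorial_Ring.prime p" and G: "pgroup p G" and H: "subgrp H" "H \<subset> G"
  shows "p * card H dvd card G" "p * card H \<le> card G"
proof -
  obtain m n where mn: "card G = p ^ n" "card H = p ^ m"
    using G pgroup_sub[OF p G H(1)] H(2) by (auto simp: pgroup_def)
  have "card H < card G" using H(2) pgroup_finite[OF G] by (simp add: psubset_card_mono)
  then have "m < n" using mn prime_gt_1_nat[OF p] by simp
  then show *: "p * card H dvd card G"
    using le_imp_power_dvd[of "Suc m" n p] by (simp add: mn)
  show "p * card H \<le> card G"
    using * mn prime_gt_0_nat[OF p] by (intro dvd_imp_le) auto
qed

section \<open>Action on quotients and central chief factors\<close>

lemma power_mult_normal:
  assumes G: "subgrp G" and L: "normal_in L G" and a: "a \<in> G" and l: "l \<in> L"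
  shows "inverse (a ^ n) * (a * l) ^ n \<in> L"
proof (induction n)
  case (Suc n)
  have "inverse (a ^ Suc n) * (a * l) ^ Suc n = (inverse a * (inverse (a ^ n) * (a * l) ^ n) * a) * l"
    unfolding power_Suc2 by (simp add: word_simps)
  then show ?case
    using subgrp_mult[OF normal_in_subgrp[OF L] normal_in_conj[OF L Suc a] l] by simp
qed (simp add: word_simps subgrp_one normal_in_subgrp[OF L])

text \<open>\<open>G\<close> acts by conjugation on the cosets of \<open>L\<close> in
  \<open>Y\<close>. If only the trivial coset were fixed, all other orbits would have size divisible
  by \<open>p\<close>, and \<open>p\<close> would divide both the number of cosets and that number
  minus 1.\<close>

lemma fixed_point_mod:
  assumes p: "Factorial_Ring.prime p" and G: "pgroup p G"
    and Y: "normal_in Y G" and L: "normal_in L G" and LY: "L \<subset> Y"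
  shows "\<exists>y\<in>Y - L. \<forall>g\<in>G. comm y g \<in> L"
proof (rule ccontr)
  assume no: "\<not> ?thesis"
  note sG = pgroup_subgrp[OF G] and sY = normal_in_subgrp[OF Y] and sL = normal_in_subgrp[OF L]
    and YG = normal_in_subset[OF Y]
  have fY: "finite Y" using G Y finite_subset by (auto simp: pgroup_def normal_in_def)
  define CS where "CS = (\<lambda>x. lcoset x L) ` Y"
  define orb where "orb = (\<lambda>y. (\<lambda>g. lcoset (g * y * inverse g) L) ` G)"
  have "card Y = card L * card CS"
    unfolding CS_def using LY by (intro card_eq_lcosets fY sY sL) auto
  moreover have "p * card L dvd card Y"
    using pgroup_index(1)[OF p pgroup_sub[OF p G sY YG] sL LY] .
  moreover have "0 < card L" using sL fY LY finite_subset[of L Y] subgrp_one card_gt_0_iff by blast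
  ultimately have pCS: "p dvd card CS" by (simp add: mult.commute)
  have conj_eq: "lcoset (g * x * inverse g) L = lcoset (g * y * inverse g) L"
    if "g \<in> G" "lcoset x L = lcoset y L" for g x y
  proof -
    have "inverse (g * x * inverse g) * (g * y * inverse g) = g * (inverse x * y) * inverse g"
      by (simp add: word_simps)
    then show ?thesis using that normal_in_conj'[OF sG L] by (simp add: lcoset_eq_iff[OF sL])
  qed
  have p_orb: "p dvd card (orb y)" if y: "y \<in> Y - L" for y
  proof -
    \<comment> \<open>The stabilizer of the coset of \<open>y\<close>.\<close>
    define K where "K = {g \<in> G. comm y (inverse g) \<in> L}"
    have "card G = card K * card (orb y)"
      unfolding orb_def
    proof (rule card_eq_cosets)
      fix g h assume gh: "g \<in> G" "h \<in> G"
      have "inverse (g * y * inverse g) * (h * y * inverse h)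
          = inverse (inverse g) * comm y (inverse (inverse g * h)) * inverse g"
        by (simp add: comm_def word_simps)
      then show "lcoset (g * y * inverse g) L = lcoset (h * y * inverse h) L \<longleftrightarrow> inverse g * h \<in> K"
        using gh normal_in_conj_iff[OF sG L, of "inverse g"]
        by (simp add: lcoset_eq_iff[OF sL] K_def subgrp_closed[OF sG])
    qed (use G in \<open>auto simp: pgroup_def K_def\<close>)
    then have "card (orb y) dvd card G" by simp
    then obtain m where m: "card (orb y) = p ^ m"
      using G divides_primepow_nat[OF p] by (auto simp: pgroup_def)
    obtain g where g: "g \<in> G" "comm y g \<notin> L" using no y by blast
    have "lcoset y L \<in> orb y" "lcoset (inverse g * y * g) L \<in> orb y"
      using subgrp_one[OF sG] g subgrp_inv[OF sG g(1)]
      by (auto simp: orb_def inv_inv inv_one intro: image_eqI[of _ _ 1] image_eqI[of _ _ "inverse g"])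
    moreover have "lcoset y L \<noteq> lcoset (inverse g * y * g) L"
      using g by (simp add: lcoset_eq_iff[OF sL] conj_eq_comm left_inv_cancel)
    moreover have "finite (orb y)" using G by (simp add: orb_def pgroup_def)
    ultimately have "card (orb y) \<noteq> 1" by (metis card_1_singletonE singletonD)
    then show ?thesis using m by (cases m) auto
  qed
  have L_one: "lcoset y L = L \<longleftrightarrow> y \<in> L" for y
    using lcoset_eq_iff[OF sL, of 1 y] by (auto simp: lcoset_def inv_one)
  have UN: "\<Union> (orb ` (Y - L)) = CS - {L}"
  proof (intro equalityI subsetI)
    fix c assume "c \<in> \<Union> (orb ` (Y - L))"
    then obtain y g where yg: "y \<in> Y" "y \<notin> L" "g \<in> G" and c: "c = lcoset (g * y * inverse g) L"
      by (auto simp: orb_def)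
    have "g * y * inverse g \<in> Y" using normal_in_conj'[OF sG Y yg(1,3)] .
    moreover have "g * y * inverse g \<notin> L"
      using yg normal_in_conj_iff[OF sG L subgrp_inv[OF sG yg(3)], of y] by (simp add: inv_inv)
    ultimately show "c \<in> CS - {L}" using c L_one by (auto simp: CS_def)
  next
    fix c assume "c \<in> CS - {L}"
    then obtain y where "y \<in> Y" "c = lcoset y L" "y \<notin> L" using L_one by (auto simp: CS_def)
    then show "c \<in> \<Union> (orb ` (Y - L))"
      using subgrp_one[OF sG] by (auto simp: orb_def inv_one intro!: bexI[of _ y] image_eqI[of _ _ 1])
  qed
  have orb_sub: "orb x \<subseteq> orb y" if x: "x \<in> Y" and y: "y \<in> Y" and meet: "orb x \<inter> orb y \<noteq> {}" for x y
  proof -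
    obtain g h where gh: "g \<in> G" "h \<in> G" "lcoset (g * x * inverse g) L = lcoset (h * y * inverse h) L"
      using meet by (auto simp: orb_def)
    show ?thesis
    proof
      fix c assume "c \<in> orb x"
      then obtain k where k: "k \<in> G" "c = lcoset (k * x * inverse k) L" by (auto simp: orb_def)
      define e where "e = k * inverse g"
      have e: "e \<in> G" using k gh sG by (simp add: e_def subgrp_closed)
      from conj_eq[OF e gh(3)] have "c = lcoset ((e * h) * y * inverse (e * h)) L"
        using k by (simp add: e_def word_simps)
      then show "c \<in> orb y" using e gh sG by (auto simp: orb_def subgrp_closed)
    qed
  qed
  have "p dvd card (\<Union> (orb ` (Y - L)))"
  proof (rule dvd_partition)
    show "finite (\<Union> (orb ` (Y - L)))" unfolding UN using fY by (simp add: CS_def)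
    show "\<forall>c\<in>orb ` (Y - L). p dvd card c" using p_orb by auto
    show "\<forall>c1\<in>orb ` (Y - L). \<forall>c2\<in>orb ` (Y - L). c1 \<noteq> c2 \<longrightarrow> c1 \<inter> c2 = {}"
    proof (intro ballI impI)
      fix c1 c2 assume "c1 \<in> orb ` (Y - L)" "c2 \<in> orb ` (Y - L)" and ne: "c1 \<noteq> c2"
      then obtain x y where xy: "x \<in> Y" "y \<in> Y" "c1 = orb x" "c2 = orb y" by blast
      then show "c1 \<inter> c2 = {}"
        using orb_sub[of x y] orb_sub[of y x] ne by (metis Int_commute subset_antisym)
    qed
  qed
  then have "p dvd card (CS - {L})" by (simp add: UN)
  moreover have LCS: "L \<in> CS" "finite CS"
    using L_one subgrp_one[OF sL] LY fY by (auto simp: CS_def intro!: image_eqI[of _ _ 1])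
  ultimately have "p dvd card CS - 1" by (simp add: card_Diff_singleton)
  moreover have "0 < card CS" using LCS card_gt_0_iff by blast
  moreover have "p dvd card CS - (card CS - 1)" using calculation(1) pCS by (rule dvd_diff_nat[rotated])
  ultimately have "p dvd 1" by simp
  then show False using prime_gt_1_nat[OF p] by simp
qed

text \<open>The union is the product of \<open>L\<close> and the cyclic group generated by
  \<open>y\<close>; \<open>p\<close> cosets suffice because \<open>y ^ p\<close> is in
  \<open>L\<close>.\<close>

lemma central_extension:
  assumes G: "subgrp G" and L: "normal_in L G" and y: "y \<in> G" and yc: "\<And>g. g \<in> G \<Longrightarrow> comm y g \<in> L"
    and yp: "y ^ p \<in> L" and p: "0 < p"
  shows "normal_in (\<Union>j<p. lcoset (y ^ j) L) G" (is "normal_in ?M G")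
    and "insert y L \<subseteq> (\<Union>j<p. lcoset (y ^ j) L)"
proof -
  note sL = normal_in_subgrp[OF L]
  have yG: "y ^ j \<in> G" for j using y G subgrp_pow by blast
  have mem: "z \<in> ?M \<longleftrightarrow> (\<exists>j. inverse (y ^ j) * z \<in> L)" for z
  proof
    assume "\<exists>j. inverse (y ^ j) * z \<in> L"
    then obtain j where j: "inverse (y ^ j) * z \<in> L" ..
    have "y ^ j = y ^ (j mod p) * (y ^ p) ^ (j div p)"
      by (metis power_mult power_add mod_mult_div_eq)
    then have "inverse (y ^ (j mod p)) * z = (y ^ p) ^ (j div p) * (inverse (y ^ j) * z)"
      by (simp add: word_simps)
    then have "inverse (y ^ (j mod p)) * z \<in> L"
      using j yp sL by (simp add: subgrp_mult subgrp_pow)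
    then show "z \<in> ?M" using p by (auto simp: mem_lcoset intro!: bexI[of _ "j mod p"])
  qed (auto simp: mem_lcoset)
  show "insert y L \<subseteq> ?M"
  proof -
    have "inverse (y ^ 1) * y \<in> L" by (simp add: left_inv subgrp_one[OF sL])
    then have "y \<in> ?M" unfolding mem ..
    moreover have "L \<subseteq> ?M" unfolding subset_iff mem by (auto simp: inv_one intro!: exI[of _ 0])
    ultimately show ?thesis by simp
  qed
  show "normal_in ?M G"
    unfolding normal_in_def subgrp_def
  proof (intro conjI ballI)
    show "1 \<in> ?M" using sL unfolding mem by (auto simp: subgrp_one inv_one intro!: exI[of _ 0])
    show "?M \<subseteq> G"
      using normal_in_subset[OF L] yG G by (auto simp: lcoset_def intro!: subgrp_mult)
    fix z assume "z \<in> ?M"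
    then obtain j where j: "inverse (y ^ j) * z \<in> L" unfolding mem by blast
    \<comment> \<open>Modulo \<open>L\<close>, \<open>y ^ d\<close> is the inverse of
      \<open>y ^ j\<close>, with a nonnegative exponent.\<close>
    define d where "d = j * (p - 1)"
    have "d + j = p * j" using p by (simp add: d_def algebra_simps)
    then have d: "y ^ d * y ^ j \<in> L"
      using subgrp_pow[OF sL yp, of j] by (simp add: power_add[symmetric] power_mult[symmetric])
    have "inverse (y ^ d) * inverse z
      = inverse (y ^ d) * (inverse (inverse (y ^ j) * z) * inverse (y ^ d * y ^ j)) * y ^ d"
      by (simp add: word_simps)
    then have "inverse (y ^ d) * inverse z \<in> L"
      using normal_in_conj[OF L subgrp_mult[OF sL subgrp_inv[OF sL j] subgrp_inv[OF sL d]] yG] by simp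
    then show "inverse z \<in> ?M" unfolding mem ..
    show "inverse g * z * g \<in> ?M" if g: "g \<in> G" for g
    proof -
      have "y ^ j \<in> {x \<in> G. \<forall>g\<in>G. comm x g \<in> L}"
        using y yc by (intro subgrp_pow subgrp_comm_set G L) auto
      then have "comm (y ^ j) g \<in> L" using g by blast
      moreover have "inverse (y ^ j) * (inverse g * z * g)
        = comm (y ^ j) g * (inverse g * (inverse (y ^ j) * z) * g)"
        by (simp add: comm_def word_simps)
      ultimately have "inverse (y ^ j) * (inverse g * z * g) \<in> L"
        using normal_in_conj[OF L j g] subgrp_mult[OF sL] by simp
      then show ?thesis unfolding mem ..
    qed
    fix w assume "w \<in> ?M"
    then obtain k where k: "inverse (y ^ k) * w \<in> L" unfolding mem by blast
    have "inverse (y ^ (j + k)) * (z * w)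
        = (inverse (y ^ k) * (inverse (y ^ j) * z) * y ^ k) * (inverse (y ^ k) * w)"
      by (simp add: power_add word_simps)
    then have "inverse (y ^ (j + k)) * (z * w) \<in> L"
      using normal_in_conj[OF L j yG] k sL by (simp add: subgrp_mult)
    then show "z * w \<in> ?M" unfolding mem ..
  qed
qed

lemma card_UN_lcoset_le:
  assumes "finite L"
  shows "card (\<Union>j<p. lcoset (y ^ j) L) \<le> p * card L"
  using card_UN_le[of "{..<p}" "\<lambda>j. lcoset (y ^ j) L"] by (simp add: card_lcoset)

text \<open>Choose \<open>L\<close> maximal among the normal subgroups containing \<open>Q\<close>
  and properly contained in \<open>Y\<close>. A fixed point modulo \<open>L\<close>, raised to a
  power to have order \<open>p\<close> there, generates with \<open>L\<close> a normal subgroup,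
  which must be \<open>Y\<close>.\<close>

lemma chief_factor:
  assumes p: "Factorial_Ring.prime p" and G: "pgroup p G"
    and Y: "normal_in Y G" and Q: "normal_in Q G" "Q \<subset> Y"
  obtains L where "normal_in L G" "Q \<subseteq> L" "L \<subset> Y" "card Y \<le> p * card L" "csub Y G \<subseteq> L"
    "\<And>y. y \<in> Y \<Longrightarrow> y ^ p \<in> L"
proof -
  note sG = pgroup_subgrp[OF G] and sY = normal_in_subgrp[OF Y] and YG = normal_in_subset[OF Y]
  have fY: "finite Y" using G Y finite_subset by (auto simp: pgroup_def normal_in_def)
  define \<L> where "\<L> = {L. normal_in L G \<and> Q \<subseteq> L \<and> L \<subset> Y}"
  have "finite \<L>" using fY finite_subset[of \<L> "Pow Y"] by (auto simp: \<L>_def)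
  moreover have "Q \<in> \<L>" using Q by (simp add: \<L>_def)
  ultimately obtain L where L: "L \<in> \<L>" and Lmax: "\<And>M. M \<in> \<L> \<Longrightarrow> L \<subseteq> M \<Longrightarrow> M = L"
    using finite_has_maximal[of \<L>] by blast
  have nL: "normal_in L G" and QL: "Q \<subseteq> L" and LY: "L \<subset> Y" using L by (auto simp: \<L>_def)
  note sL = normal_in_subgrp[OF nL] and LG = normal_in_subset[OF nL]
  define Z where "Z = {x \<in> G. \<forall>g\<in>G. comm x g \<in> L}"
  have sZ: "subgrp Z" unfolding Z_def by (intro subgrp_comm_set sG nL) simp
  obtain y0 where y0: "y0 \<in> Y" "y0 \<notin> L" "y0 \<in> Z"
    using fixed_point_mod[OF p G Y nL LY] YG by (auto simp: Z_def)
  obtain n where n: "card G = p ^ n" using G by (auto simp: pgroup_def)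
  then have "y0 ^ (p ^ n) \<in> L"
    using pow_card_eq_one[OF sG pgroup_finite[OF G], of y0] y0 YG subgrp_one[OF sL] by auto
  then have ex: "\<exists>e. y0 ^ (p ^ e) \<in> L" by blast
  \<comment> \<open>Minimality of \<open>e\<close> puts the \<open>p ^ (e - 1)\<close>-th power of
    \<open>y0\<close> outside \<open>L\<close>, while its \<open>p\<close>-th power is
    inside.\<close>
  define e where "e = (LEAST e. y0 ^ (p ^ e) \<in> L)"
  have e: "y0 ^ (p ^ e) \<in> L" unfolding e_def using ex by (rule LeastI_ex)
  have "e \<noteq> 0" using e y0 by (auto intro: ccontr)
  define y where "y = y0 ^ (p ^ (e - 1))"
  have y: "y \<in> Y" "y \<in> Z" using y0 sY sZ by (simp_all add: y_def subgrp_pow)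
  have "y \<notin> L" 
    using \<open>e \<noteq> 0\<close> not_less_Least[of "e - 1" "\<lambda>e. y0 ^ (p ^ e) \<in> L"] by (simp add: y_def e_def[symmetric])
  have yp: "y ^ p \<in> L"
    using e \<open>e \<noteq> 0\<close> by (cases e) (simp_all add: y_def power_mult[symmetric] mult.commute)
  define M where "M = (\<Union>j<p. lcoset (y ^ j) L)"
  have "normal_in M G" and LM: "insert y L \<subseteq> M"
    unfolding M_def using y YG prime_gt_0_nat[OF p]
    by (intro central_extension[OF sG nL _ _ yp]; auto simp: Z_def)+
  moreover have "M \<subseteq> Y"
    unfolding M_def using y LY sY by (auto simp: lcoset_def intro!: subgrp_mult subgrp_pow)
  ultimately have "M = Y" using Lmax[of M] QL \<open>y \<notin> L\<close> unfolding \<L>_def by blast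
  have "L \<subseteq> Z" using LG comm_in_normal[OF sG nL] by (auto simp: Z_def)
  then have "M \<subseteq> Z"
    unfolding M_def using y sZ by (auto simp: lcoset_def intro!: subgrp_mult subgrp_pow)
  then have YGL: "csub Y G \<subseteq> L" unfolding \<open>M = Y\<close> by (intro csub_least sL) (auto simp: Z_def)
  have ypow: "z ^ p \<in> L" if zY: "z \<in> Y" for z
  proof -
    obtain j where j: "inverse (y ^ j) * z \<in> L" using zY \<open>M = Y\<close> by (auto simp: M_def mem_lcoset)
    have "inverse ((y ^ j) ^ p) * (y ^ j * (inverse (y ^ j) * z)) ^ p \<in> L"
      using y YG by (intro power_mult_normal[OF sG nL _ j] subgrp_pow[OF sG]) auto
    moreover have "(y ^ j) ^ p \<in> L"
      using subgrp_pow[OF sL yp, of j] by (simp add: power_mult[symmetric] mult.commute)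
    ultimately show ?thesis
      using subgrp_mult_left_iff[OF sL subgrp_inv[OF sL]] by (simp add: right_inv_cancel)
  qed
  have "card Y \<le> p * card L"
    using card_UN_lcoset_le[of L y p] finite_subset[of L Y] LY fY \<open>M = Y\<close> by (auto simp: M_def)
  then show ?thesis using that nL QL LY YGL ypow by blast
qed

end

section \<open>Potently embedded subgroups\<close>

context mgroup
begin

text \<open>\<open>N\<close> has weight 1; truncated subtraction makes \<open>S 0\<close> equal to
  \<open>S 1\<close>.\<close>

lemma lcs_filtration:
  assumes G: "subgrp G" and N: "normal_in N G"
  shows "filtration (\<lambda>j. lcs N G (j - 1))"
  unfolding filtration_def
proof (intro conjI allI ballI)
  note NG = normal_in_lcs[OF G N normal_in_self[OF G]]
  show "subgrp (lcs N G (j - 1))" for j using normal_in_subgrp[OF NG] .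
  show "lcs N G (Suc j - 1) \<subseteq> lcs N G (j - 1)" for j
    by (rule lcs_antimono[OF G N normal_in_self[OF G]]) simp
  fix i j x y assume xy: "x \<in> lcs N G (i - 1)" "y \<in> lcs N G (j - 1)"
  then have "comm x y \<in> lcs N G ((i - 1) + (j - 1) + 1)"
    using csub_lcs_lcs'[OF G N] comm_in_csub by blast
  moreover have "i + j - 1 \<le> (i - 1) + (j - 1) + 1" by linarith
  ultimately show "comm x y \<in> lcs N G (i + j - 1)"
    using lcs_antimono[OF G N normal_in_self[OF G]] by blast
qed simp

lemma power_mult_mod_central:
  assumes G: "subgrp G" and T: "normal_in T G" and w: "w \<in> G" and y: "y \<in> G"
    and c: "\<And>n. comm (y ^ n) w \<in> T"
  shows "inverse (y ^ n) * inverse (w ^ n) * (w * y) ^ n \<in> T"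
proof (induction n)
  case (Suc n)
  define t where "t = inverse (y ^ n) * inverse (w ^ n) * (w * y) ^ n"
  have "inverse (y ^ Suc n) * inverse (w ^ Suc n) * (w * y) ^ Suc n
      = inverse y * (comm (y ^ n) w * (inverse w * t * w)) * y"
    unfolding power_Suc2 t_def by (simp add: comm_def word_simps)
  also have "\<dots> \<in> T"
    using Suc c w y by (intro normal_in_conj[OF T] subgrp_mult[OF normal_in_subgrp[OF T]]) (auto simp: t_def)
  finally show ?case .
qed (simp add: word_simps subgrp_one normal_in_subgrp[OF T])

text \<open>\<open>B\<close> is central modulo \<open>M\<close>, so taking \<open>n\<close>-th
  powers is a homomorphism on \<open>B\<close> modulo \<open>M\<close>, and the set is the preimage
  of \<open>E\<close>.\<close>

lemma subgrp_power_set: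
  assumes G: "subgrp G" and B: "normal_in B G" and M: "normal_in M G" and E: "subgrp E" "M \<subseteq> E"
    and BM: "csub B G \<subseteq> M"
  shows "subgrp {w \<in> B. w ^ n \<in> E}"
  unfolding subgrp_def
proof (intro conjI ballI)
  note sB = normal_in_subgrp[OF B] and BG = normal_in_subset[OF B]
  show "1 \<in> {w \<in> B. w ^ n \<in> E}" by (simp add: subgrp_one sB E)
  fix w assume w: "w \<in> {w \<in> B. w ^ n \<in> E}"
  then show "inverse w \<in> {w \<in> B. w ^ n \<in> E}" by (simp add: subgrp_inv sB E inv_pow)
  fix y assume y: "y \<in> {w \<in> B. w ^ n \<in> E}"
  have "comm (y ^ m) w \<in> M" for m
    using w y BG subgrp_pow[OF sB, of y m] by (intro subsetD[OF BM] comm_in_csub) auto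
  then have "inverse (y ^ n) * inverse (w ^ n) * (w * y) ^ n \<in> M"
    using w y BG by (intro power_mult_mod_central[OF G M]) auto
  then have "w ^ n * (y ^ n * (inverse (y ^ n) * inverse (w ^ n) * (w * y) ^ n)) \<in> E"
    using w y subgrp_mult[OF E(1) _ subgrp_mult[OF E(1) _ subsetD[OF E(2)]]] by blast
  then have "(w * y) ^ n \<in> E" by (simp add: word_simps)
  then show "w * y \<in> {w \<in> B. w ^ n \<in> E}" using w y sB by (simp add: subgrp_mult)
qed

text \<open>For \<open>w\<close> in \<open>lcs N G m\<close> and \<open>y = comm w g\<close>, the
  commutator of \<open>w ^ p\<close> and \<open>g\<close> is \<open>y ^ p\<close> modulo the next
  but one term, as \<open>y\<close> and \<open>w\<close> commute there. Products of
  \<open>p\<close>-th powers are then handled by generators.\<close>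

lemma csub_pow_sub_lcs:
  assumes G: "subgrp G" and N: "normal_in N G"
  shows "lcs (pow_sub N p) G m \<subseteq> sprod (pow_sub (lcs N G m) p) (lcs N G (Suc m))"
proof (induction m)
  case 0
  show ?case
    using sprod_incl(1)[OF subgrp_pow_sub subgrp_csub] by simp
next
  case (Suc m)
  note NG = normal_in_lcs[OF G N normal_in_self[OF G]]
  define T where "T = lcs N G (Suc (Suc m))"
  define J where "J = sprod (pow_sub (lcs N G (Suc m)) p) T"
  have T: "normal_in T G" unfolding T_def by (rule NG)
  have J: "normal_in J G" unfolding J_def by (intro normal_in_sprod normal_in_pow_sub NG G T)
  have "lcs (pow_sub N p) G (Suc m) \<subseteq> csub (sprod (pow_sub (lcs N G m) p) (lcs N G (Suc m))) G"
    using Suc by (simp add: csub_mono)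
  also have "\<dots> \<subseteq> J"
  proof (rule csub_sprod_left[OF G _ _ order_refl J])
    show "lcs N G (Suc m) \<subseteq> G" "pow_sub (lcs N G m) p \<subseteq> G"
      using NG normal_in_pow_sub[OF G NG] normal_in_subset by blast+
    show "csub (lcs N G (Suc m)) G \<subseteq> J"
      using sprod_incl(2)[OF subgrp_pow_sub normal_in_subgrp[OF T]] by (simp add: J_def T_def)
    show "csub (pow_sub (lcs N G m) p) G \<subseteq> J"
      unfolding pow_sub_def[of "lcs N G m"]
    proof (rule csub_gen_left[OF G J order_refl])
      show "{x ^ p |x. x \<in> lcs N G m} \<subseteq> G"
        using normal_in_subset[OF NG] G subgrp_pow by blast
      fix s g assume "s \<in> {x ^ p |x. x \<in> lcs N G m}" and g: "g \<in> G"
      then obtain w where w: "s = w ^ p" "w \<in> lcs N G m" by blast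
      define y where "y = comm w g"
      have y: "y \<in> lcs N G (Suc m)" using w g by (simp add: y_def comm_in_csub)
      have wG: "w \<in> G" and yG: "y \<in> G" using w y normal_in_subset[OF NG] by blast+
      have "comm (y ^ n) w \<in> T" for n
        using subgrp_pow[OF normal_in_subgrp[OF NG] y, of n] wG by (simp add: T_def comm_in_csub)
      then have "inverse (y ^ p) * inverse (w ^ p) * (w * y) ^ p \<in> T"
        by (intro power_mult_mod_central[OF G T wG yG])
      moreover have "comm s g = y ^ p * (inverse (y ^ p) * inverse (w ^ p) * (w * y) ^ p)"
        unfolding w(1) y_def conj_eq_comm[symmetric] conj_pow by (simp add: comm_def word_simps)
      ultimately show "comm s g \<in> J"
        unfolding J_def using y by (metis sprodI pow_in_pow_sub)
    qed
  qed
  finally show ?case by (simp add: J_def T_def)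
qed

end

text \<open>The alternative \<open>k_i\<close> is what the Hall-Petrescu term with index
  \<open>p\<close> needs: for \<open>k + 2 \<le> p\<close> its base is trivial modulo
  \<open>L\<close>; otherwise only the \<open>p\<close>-th power of the base is, and
  \<open>2 \<le> i\<close> supplies the factor \<open>p\<close> in
  \<open>p ^ (i - 1)\<close>.\<close>

locale potent_setup =
  fixes G :: "'a::mgroup set" and p k i :: nat
  assumes prime_p: "Factorial_Ring.prime p" and pgroup_G: "pgroup p G"
    and i_pos: "0 < i" and k_less: "k < p" and k_i: "k + 2 \<le> p \<or> 2 \<le> i"
begin

lemmas sG = pgroup_subgrp[OF pgroup_G]
  and fG = pgroup_finite[OF pgroup_G]

abbreviation q :: nat where "q \<equiv> p ^ i"

text \<open>If this failed, a chief factor \<open>Y / L\<close> between the two sides would make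
  \<open>lcs N G\<close> small enough modulo \<open>L\<close> for regularity, which turns
  \<open>comm n g ^ q \<in> L\<close> into \<open>comm (n ^ q) g \<in> L\<close>.\<close>

lemma csub_pow_sub:
  assumes N: "normal_in N G" and M: "normal_in M G"
    and NM: "lcs N G k \<subseteq> sprod (pow_sub N q) M"
  shows "csub (pow_sub N q) G \<subseteq> sprod (pow_sub (csub N G) q) M"
proof (rule ccontr)
  assume contr: "\<not> ?thesis"
  note nG = normal_in_self[OF sG]
  define Q where "Q = sprod (pow_sub (csub N G) q) M"
  define Y where "Y = sprod (csub (pow_sub N q) G) Q"
  have Q: "normal_in Q G"
    unfolding Q_def by (intro normal_in_sprod normal_in_pow_sub normal_in_csub sG N M nG)
  have P: "normal_in (pow_sub N q) G" by (intro normal_in_pow_sub sG N)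
  have Y: "normal_in Y G"
    unfolding Y_def by (intro normal_in_sprod normal_in_csub sG P nG Q)
  have QY: "Q \<subseteq> Y" "csub (pow_sub N q) G \<subseteq> Y"
    unfolding Y_def using sprod_incl[OF subgrp_csub normal_in_subgrp[OF Q]] by auto
  then have "Q \<subset> Y" using contr by (auto simp: Q_def)
  from chief_factor[OF prime_p pgroup_G Y Q this] obtain L where
    L: "normal_in L G" "Q \<subseteq> L" "L \<subset> Y" and YL: "csub Y G \<subseteq> L" and Yp: "\<And>y. y \<in> Y \<Longrightarrow> y ^ p \<in> L"
    by metis
  have MQ: "M \<subseteq> Q" "pow_sub (csub N G) q \<subseteq> Q"
    unfolding Q_def using sprod_incl[OF subgrp_pow_sub normal_in_subgrp[OF M]] by auto
  have "csub M G \<subseteq> Y" using csub_normal_subset[OF sG M] MQ QY by blast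
  then have "csub (sprod (pow_sub N q) M) G \<subseteq> Y"
    using normal_in_subset P M Y QY by (intro csub_sprod_left[OF sG]) auto
  then have k1: "lcs N G (Suc k) \<subseteq> Y" using csub_mono[OF NM order_refl] by fastforce
  have k2: "lcs N G (Suc (Suc k)) \<subseteq> L" using csub_mono[OF k1 order_refl] YL by (simp only: lcs.simps) blast
  have anti: "lcs N G n \<subseteq> lcs N G m" if "m \<le> n" for m n by (rule lcs_antimono[OF sG N nG that])
  have "comm (n ^ q) g \<in> L" if n: "n \<in> N" and g: "g \<in> G" for n g
  proof -
    \<comment> \<open>\<open>comm n g\<close> has weight 2, so \<open>t0 = 2\<close> is allowed and
      the condition on the class is one step weaker. The right-hand element is
      \<open>comm (n ^ q) g\<close> in disguise, since \<open>n * comm n g\<close> is a conjugate of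
      \<open>n\<close>.\<close>
    have "comm n g ^ q \<in> L \<longleftrightarrow> inverse (n ^ q) * (n * comm n g) ^ q \<in> L"
    proof (rule regular_mod[OF lcs_filtration[OF sG N] normal_in_subgrp[OF L(1)] prime_p i_pos, where t0 = 2 and t = 2])
      show "inverse s * l * s \<in> L" if "s \<in> lcs N G (1 - 1)" "l \<in> L" for s l
        using that normal_in_subset[OF N] by (intro normal_in_conj[OF L(1)]) auto
      show "lcs N G (p + 2 - 1) \<subseteq> L" using anti[of "Suc (Suc k)" "p + 2 - 1"] k2 k_less by simp
      show "s ^ (p ^ (i - 1)) \<in> L" if s: "s \<in> lcs N G (p + 2 - 1 - 1)" for s
      proof (cases "k + 2 \<le> p")
        case True
        then have "s \<in> L" using anti[of "Suc (Suc k)" "p + 2 - 1 - 1"] k2 s by auto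
        then show ?thesis by (intro subgrp_pow normal_in_subgrp[OF L(1)])
      next
        case False
        then have "2 \<le> i" using k_i by simp
        then have "p ^ (i - 1) = p * p ^ (i - 2)" by (metis Suc_1 Suc_diff_Suc Suc_le_lessD power_Suc)
        moreover have "s \<in> Y" using anti[of "Suc k" "p + 2 - 1 - 1"] k1 s k_less by auto
        ultimately show ?thesis
          using Yp subgrp_pow[OF normal_in_subgrp[OF L(1)]] by (simp add: power_mult)
      qed
    qed (use n g in \<open>auto simp: comm_in_csub\<close>)
    moreover have "comm n g ^ q \<in> L"
      using n g MQ L by (intro subsetD[OF L(2)] subsetD[OF MQ(2)] pow_in_pow_sub comm_in_csub)
    ultimately have "inverse (n ^ q) * (n * comm n g) ^ q \<in> L" by simp
    then show ?thesis unfolding conj_eq_comm[symmetric] conj_pow by (simp add: comm_def word_simps)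
  qed
  then have "csub (pow_sub N q) G \<subseteq> L"
    unfolding pow_sub_def using normal_in_subset[OF N] subgrp_pow[OF sG]
    by (intro csub_gen_left[OF sG L(1)]) auto
  then have "Y \<subseteq> L" unfolding Y_def by (intro sprod_least normal_in_subgrp[OF L(1)] L(2))
  then show False using L(3) by blast
qed

text \<open>
  \<open>N\<close> is minimal among the normal subgroups \<open>N \<le> C\<close> with \<open>[N, G, \<dots>, G] \<le> N\<^sup>q M\<close> and \<open>N\<^sup>q\<close> not
  contained in \<open>M\<close>. Both \<open>[N, G]\<close> and \<open>N\<^sup>p\<close> inherit the first property, so their \<open>q\<close>-th powers lie in \<open>M\<close>.
\<close>
lemma minimal_potent:
  assumes C: "normal_in C G" and M: "normal_in M G" and MC: "M \<subset> pow_sub C q"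
    and Ck: "lcs C G k \<subseteq> pow_sub C q"
  obtains N where "normal_in N G" "N \<subseteq> C" "\<not> pow_sub N q \<subseteq> M"
    "csub (pow_sub N q) G \<subseteq> M" "lcs N G (Suc k) \<subseteq> M"
    "\<And>w. w \<in> pow_sub N q \<Longrightarrow> w ^ p \<in> M" "\<And>w. w \<in> lcs N G k \<Longrightarrow> w ^ p \<in> M"
proof -
  note nG = normal_in_self[OF sG] and sM = normal_in_subgrp[OF M] and MG = normal_in_subset[OF M]
  define \<N> where "\<N> = {N. normal_in N G \<and> N \<subseteq> C \<and> lcs N G k \<subseteq> sprod (pow_sub N q) M \<and> \<not> pow_sub N q \<subseteq> M}"
  have "finite \<N>"
    using fG normal_in_subset[OF C] finite_subset[of \<N> "Pow G"] by (auto simp: \<N>_def)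
  moreover have "C \<in> \<N>"
    using C MC Ck sprod_incl(1)[OF subgrp_pow_sub sM, of C q] by (auto simp: \<N>_def)
  ultimately obtain N where N\<N>: "N \<in> \<N>" and Nmin: "\<And>K. K \<in> \<N> \<Longrightarrow> K \<subseteq> N \<Longrightarrow> K = N"
    using finite_has_minimal[of \<N>] by blast
  have N: "normal_in N G" and NC: "N \<subseteq> C" and Nk: "lcs N G k \<subseteq> sprod (pow_sub N q) M"
    and NM: "\<not> pow_sub N q \<subseteq> M" using N\<N> by (auto simp: \<N>_def)
  have min: "pow_sub K q \<subseteq> M"
    if "normal_in K G" "K \<subset> N" "lcs K G k \<subseteq> sprod (pow_sub K q) M" for K
    using that Nmin[of K] NC by (auto simp: \<N>_def)
  have P: "normal_in (pow_sub N q) G" by (intro normal_in_pow_sub sG N)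
  have "{1} \<subset> N"
  proof -
    have "N \<noteq> {1}"
    proof
      assume "N = {1}"
      then have "pow_sub N q \<subseteq> M" by (intro pow_sub_least sM) (simp add: subgrp_one[OF sM])
      then show False using NM by blast
    qed
    then show ?thesis using subgrp_one[OF normal_in_subgrp[OF N]] by auto
  qed
  \<comment> \<open>\<open>L\<close> serves to show that both the commutator subgroup
    \<open>csub N G\<close> and \<open>pow_sub N p\<close> are proper in \<open>N\<close>, so
    minimality applies to them.\<close>
  from chief_factor[OF prime_p pgroup_G N normal_in_trivial[OF sG] this] obtain L
    where L: "normal_in L G" "L \<subset> N" "csub N G \<subseteq> L" "\<And>y. y \<in> N \<Longrightarrow> y ^ p \<in> L"
    by metis
  define B where "B = sprod (pow_sub N q) M"
  have B: "normal_in B G" unfolding B_def by (intro normal_in_sprod sG P M)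
  have PB: "pow_sub N q \<subseteq> B" "M \<subseteq> B" unfolding B_def using sprod_incl[OF subgrp_pow_sub sM] by auto
  have N1: "pow_sub (csub N G) q \<subseteq> M"
  proof (rule min)
    show "normal_in (csub N G) G" by (intro normal_in_csub sG N nG)
    show "csub N G \<subset> N" using L by blast
    define E where "E = sprod (pow_sub (csub N G) q) M"
    have E: "normal_in E G"
      unfolding E_def by (intro normal_in_sprod normal_in_pow_sub normal_in_csub sG N M nG)
    have ME: "M \<subseteq> E" unfolding E_def using sprod_incl[OF subgrp_pow_sub sM] by auto
    have "lcs (csub N G) G k = csub (lcs N G k) G"
      using lcs_add[of N G 1 k] by simp
    also have "\<dots> \<subseteq> csub (sprod (pow_sub N q) M) G" by (intro csub_mono Nk order_refl)
    also have "\<dots> \<subseteq> E"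
    proof (rule csub_sprod_left[OF sG normal_in_subset[OF P] MG order_refl E])
      show "csub (pow_sub N q) G \<subseteq> E" unfolding E_def by (rule csub_pow_sub[OF N M Nk])
      show "csub M G \<subseteq> E" using csub_normal_subset[OF sG M order_refl] ME by blast
    qed
    finally show "lcs (csub N G) G k \<subseteq> sprod (pow_sub (csub N G) q) M" by (simp add: E_def)
  qed
  have c1: "csub (pow_sub N q) G \<subseteq> M"
    using csub_pow_sub[OF N M Nk] sprod_least[OF sM N1 order_refl] by blast
  have BM: "csub B G \<subseteq> M"
    unfolding B_def using csub_normal_subset[OF sG M order_refl]
    by (intro csub_sprod_left[OF sG normal_in_subset[OF P] MG order_refl M c1])
  have c2: "lcs N G (Suc k) \<subseteq> M"
    using csub_mono[OF Nk order_refl] BM by (simp add: B_def) blast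
  define E where "E = sprod (pow_sub (pow_sub N p) q) M"
  have sE: "subgrp E"
    unfolding E_def by (intro subgrp_sprod[OF sG] normal_in_subset[OF normal_in_pow_sub] normal_in_pow_sub sG N subgrp_pow_sub M)
  have ME: "M \<subseteq> E" "pow_sub (pow_sub N p) q \<subseteq> E"
    unfolding E_def using sprod_incl[OF subgrp_pow_sub sM] by auto
  \<comment> \<open>\<open>B\<close> is central modulo \<open>M\<close>, so this may be checked on
    the generators \<open>n ^ q\<close>, where the exponents \<open>p\<close> and \<open>q\<close>
    are exchanged.\<close>
  have Bp: "w ^ p \<in> E" if "w \<in> B" for w
  proof -
    have s: "subgrp {w \<in> B. w ^ p \<in> E}" by (rule subgrp_power_set[OF sG B M sE ME(1) BM])
    have "pow_sub N q \<subseteq> {w \<in> B. w ^ p \<in> E}"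
    proof (rule pow_sub_least[OF s])
      fix n assume n: "n \<in> N"
      have "(n ^ q) ^ p = (n ^ p) ^ q" by (simp add: power_mult[symmetric] mult.commute)
      then have "(n ^ q) ^ p \<in> E"
        using n ME by (metis pow_in_pow_sub subsetD)
      then show "n ^ q \<in> {w \<in> B. w ^ p \<in> E}" using n PB pow_in_pow_sub by blast
    qed
    moreover have "M \<subseteq> {w \<in> B. w ^ p \<in> E}" using PB ME subgrp_pow[OF sM] by blast
    ultimately have "B \<subseteq> {w \<in> B. w ^ p \<in> E}" unfolding B_def by (intro sprod_least[OF s[unfolded B_def]])
    then show ?thesis using that by blast
  qed
  have N2: "pow_sub (pow_sub N p) q \<subseteq> M"
  proof (rule min)
    show "normal_in (pow_sub N p) G" by (intro normal_in_pow_sub sG N)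
    have "pow_sub N p \<subseteq> L" using L by (intro pow_sub_least normal_in_subgrp[OF L(1)])
    then show "pow_sub N p \<subset> N" using L by blast
    have "pow_sub (lcs N G k) p \<subseteq> E"
      using Nk Bp by (intro pow_sub_least sE) (auto simp: B_def)
    then have "sprod (pow_sub (lcs N G k) p) (lcs N G (Suc k)) \<subseteq> E"
      using c2 ME by (intro sprod_least sE) auto
    then show "lcs (pow_sub N p) G k \<subseteq> sprod (pow_sub (pow_sub N p) q) M"
      using csub_pow_sub_lcs[OF sG N, of p k] by (auto simp: E_def)
  qed
  then have "E \<subseteq> M" unfolding E_def by (intro sprod_least sM order_refl)
  then have "w ^ p \<in> M" if "w \<in> B" for w using Bp[OF that] by blast
  then show ?thesis using Nk PB by (intro that[OF N NC NM c1 c2]) (auto simp: B_def)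
qed

text \<open>With \<open>N\<close> from \<open>minimal_potent\<close> take \<open>u\<close> in
  \<open>N\<close> with \<open>v = u ^ q\<close> outside \<open>M\<close>; then \<open>v\<close> and
  \<open>M\<close> generate an \<open>M'\<close> of order \<open>p * card M\<close>. The roots of
  \<open>M'\<close> split into \<open>p\<close> sets, each a left translate of
  \<open>roots G q M\<close> by a power of \<open>u\<close>.\<close>

lemma card_roots_step:
  assumes C: "normal_in C G" and M: "normal_in M G" and MC: "M \<subset> pow_sub C q"
    and Ck: "lcs C G k \<subseteq> pow_sub C q"
  obtains M' where "normal_in M' G" "M \<subset> M'" "M' \<subseteq> pow_sub C q"
    "card (roots G q M') * card M = card (roots G q M) * card M'"
proof -
  note nG = normal_in_self[OF sG] and sM = normal_in_subgrp[OF M] and MG = normal_in_subset[OF M]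
  obtain N where N: "normal_in N G" and NC: "N \<subseteq> C" and NM: "\<not> pow_sub N q \<subseteq> M"
    and c1: "csub (pow_sub N q) G \<subseteq> M" and c2: "lcs N G (Suc k) \<subseteq> M"
    and c3: "\<And>w. w \<in> pow_sub N q \<Longrightarrow> w ^ p \<in> M" and c4: "\<And>w. w \<in> lcs N G k \<Longrightarrow> w ^ p \<in> M"
    using minimal_potent[OF C M MC Ck] by metis
  note NG = normal_in_subset[OF N]
  obtain u where u: "u \<in> N" "u ^ q \<notin> M" using NM pow_sub_least[OF sM, of N q] by blast
  define v where "v = u ^ q"
  have v: "v \<in> pow_sub N q" unfolding v_def by (rule pow_in_pow_sub[OF u(1)])
  then have vG: "v \<in> G" using normal_in_subset[OF normal_in_pow_sub[OF sG N]] by blast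
  define M' where "M' = (\<Union>j<p. lcoset (v ^ j) M)"
  note p0 = prime_gt_0_nat[OF prime_p]
  have "comm v g \<in> M" if "g \<in> G" for g using c1 comm_in_csub[OF v that] by blast
  note ext = central_extension[OF sG M vG this c3[OF v] p0, folded M'_def]
  have sM': "subgrp M'" and MM': "M \<subset> M'"
    using normal_in_subgrp[OF ext(1)] ext(2) u(2) by (auto simp: v_def)
  have M'C: "M' \<subseteq> pow_sub C q"
    using v pow_sub_mono[OF NC, of q] MC
    by (auto simp: M'_def lcoset_def intro!: subgrp_mult[OF subgrp_pow_sub] subgrp_pow[OF subgrp_pow_sub])
  have card_M': "card M' = p * card M"
  proof (rule antisym)
    show "card M' \<le> p * card M"
      unfolding M'_def using fG MG finite_subset by (intro card_UN_lcoset_le) auto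
    show "p * card M \<le> card M'"
      using pgroup_index(2)[OF prime_p pgroup_sub[OF prime_p pgroup_G sM' normal_in_subset[OF ext(1)]] sM MM'] .
  qed
  have reg: "(u ^ j * x) ^ q \<in> M \<longleftrightarrow> v ^ j * x ^ q \<in> M" if x: "x \<in> G" for j x
  proof -
    have uG: "u \<in> G" using u NG by blast
    define A where "A = gen {u, x}"
    have A: "subgrp A" "u \<in> A" "x \<in> A" "A \<subseteq> G"
      using uG x gen_least[OF sG, of "{u, x}"] by (auto simp: A_def subgrp_gen intro: gen_incl)
    \<comment> \<open>\<open>x\<close> need not lie in \<open>N\<close>, so weight 1 must be
      \<open>A\<close>. As \<open>u\<close> is in \<open>N\<close>, the derived subgroup of
      \<open>A\<close> is still contained in \<open>lcs N G 1\<close>.\<close>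
    define S where "S = (\<lambda>j. if j \<le> 1 then A else A \<inter> lcs N G (j - 1))"
    note lN = normal_in_lcs[OF sG N nG] and F = lcs_filtration[OF sG N]
    have anti: "lcs N G n \<subseteq> lcs N G m" if "m \<le> n" for m n by (rule lcs_antimono[OF sG N nG that])
    have "filtration S"
      unfolding filtration_def
    proof (intro conjI allI ballI)
      show "S 0 = S 1" by (simp add: S_def)
      show "subgrp (S j)" for j using A normal_in_subgrp[OF lN] by (simp add: S_def subgrp_Int)
      show "S (Suc j) \<subseteq> S j" for j using anti[of "j - 1" j] by (auto simp: S_def)
      fix a b y z assume y: "y \<in> S a" and z: "z \<in> S b"
      have yz: "y \<in> A" "z \<in> A" using y z by (auto simp: S_def split: if_splits)
      then have cA: "comm y z \<in> A" by (simp add: subgrp_comm A)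
      have "comm y z \<in> lcs N G (a + b - 1)" if ab: "2 \<le> a + b"
      proof -
        consider "2 \<le> a" "2 \<le> b" | "a \<le> 1" "2 \<le> b" | "2 \<le> a" "b \<le> 1" | "a = 1" "b = 1" using ab by linarith
        then show ?thesis
        proof cases
          case 1
          then show ?thesis using filtration_comm[OF F, of y a z b] y z by (simp add: S_def)
        next
          case 2
          then have "z \<in> lcs N G (b - 1)" using z by (simp add: S_def)
          then have "comm z y \<in> lcs N G b"
            using comm_in_csub[of z "lcs N G (b - 1)" y G] yz A 2 by (cases b) auto
          then have "comm y z \<in> lcs N G b"
            using comm_in_swap[OF normal_in_subgrp[OF lN]] by blast
          moreover have "a + b - 1 \<le> b" using 2 by linarith
          ultimately show ?thesis using anti by blast
        next
          case 3
          then have "y \<in> lcs N G (a - 1)" using y by (simp add: S_def)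
          then have "comm y z \<in> lcs N G a"
            using comm_in_csub[of y "lcs N G (a - 1)" z G] yz A 3 by (cases a) auto
          moreover have "a + b - 1 \<le> a" using 3 by linarith
          ultimately show ?thesis using anti by blast
        next
          case 4
          have "csub A A \<subseteq> lcs N G 1"
            unfolding A_def using uG x u by (intro gen_pair_comm[OF sG lN]) (simp_all add: comm_in_csub)
          then show ?thesis using comm_in_csub[OF yz] 4 by auto
        qed
      qed
      then show "comm y z \<in> S (a + b)" using cA by (auto simp: S_def)
    qed
    \<comment> \<open>Regularity for the pair \<open>inverse (u ^ j)\<close> and
      \<open>u ^ j * x\<close>, whose product is \<open>x\<close>.\<close>
    then have "(u ^ j * x) ^ q \<in> M \<longleftrightarrow> inverse (inverse (u ^ j) ^ q) * (inverse (u ^ j) * (u ^ j * x)) ^ q \<in> M"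
    proof (rule regular_mod[OF _ sM prime_p i_pos, where t0 = 1 and t = 1])
      show "inverse s * l * s \<in> M" if "s \<in> S 1" "l \<in> M" for s l
        using that A by (intro normal_in_conj[OF M]) (auto simp: S_def)
      have "lcs N G p \<subseteq> M" using anti[of "Suc k" p] k_less c2 by (blast dest: Suc_leI)
      then show "S (p + 1) \<subseteq> M" using prime_gt_0_nat[OF prime_p] by (auto simp: S_def)
      show "s ^ (p ^ (i - 1)) \<in> M" if "s \<in> S (p + 1 - 1)" for s
      proof -
        have s: "s \<in> lcs N G (p - 1)" using that prime_ge_2_nat[OF prime_p] by (simp add: S_def)
        show ?thesis
        proof (cases "k + 2 \<le> p")
          case True
          then have "Suc k \<le> p - 1" by linarith
          then have "s \<in> M" using anti c2 s by blast
          then show ?thesis by (rule subgrp_pow[OF sM])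
        next
          case False
          then have "2 \<le> i" using k_i by simp
          then have "p ^ (i - 1) = p * p ^ (i - 2)"
            by (metis Suc_1 Suc_diff_Suc Suc_le_lessD power_Suc)
          moreover have "k \<le> p - 1" using k_less by linarith
          then have "s \<in> lcs N G k" using anti s by blast
          ultimately show ?thesis using c4 subgrp_pow[OF sM] by (simp add: power_mult)
        qed
      qed
      show "inverse (u ^ j) \<in> S 1" "u ^ j * x \<in> S 1"
        using A by (simp_all add: S_def subgrp_closed)
    qed simp_all
    moreover have "inverse (inverse (u ^ j) ^ q) = v ^ j"
      by (simp add: v_def inv_pow inv_inv power_mult[symmetric] mult.commute)
    ultimately show ?thesis by (simp add: left_inv_cancel)
  qed
  define R where "R = (\<lambda>j. {x \<in> G. v ^ j * x ^ q \<in> M})"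
  have card_R: "card (R j) = card (roots G q M)" for j
  proof (rule bij_betw_same_card)
    have uj: "u ^ j \<in> G" using u NG sG subgrp_pow by blast
    show "bij_betw (\<lambda>x. u ^ j * x) (R j) (roots G q M)"
    proof (rule bij_betw_byWitness[where f' = "\<lambda>x. inverse (u ^ j) * x"])
      show "(\<lambda>x. inverse (u ^ j) * x) ` roots G q M \<subseteq> R j"
        using reg[of "inverse (u ^ j) * _" j] uj sG by (auto simp: R_def roots_def subgrp_mult subgrp_inv right_inv_cancel)
    qed (use reg uj sG in \<open>auto simp: R_def roots_def left_inv_cancel right_inv_cancel subgrp_mult\<close>)
  qed
  have "roots G q M' = (\<Union>j<p. R j)"
  proof -
    have "x ^ q \<in> M' \<longleftrightarrow> (\<exists>j<p. v ^ j * x ^ q \<in> M)" for x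
    proof
      assume "x ^ q \<in> M'"
      then have "inverse (x ^ q) \<in> M'" by (rule subgrp_inv[OF sM'])
      then obtain j where j: "j < p" "inverse (v ^ j) * inverse (x ^ q) \<in> M" by (auto simp: M'_def mem_lcoset)
      then have "inverse (x ^ q * v ^ j) \<in> M" by (simp add: inv_mult)
      then have "x ^ q * v ^ j \<in> M" by (simp add: subgrp_inv_iff[OF sM])
      then have "v ^ j * x ^ q \<in> M"
        using normal_in_swap[OF sG M] vG subgrp_pow[OF sG] by blast
      then show "\<exists>j<p. v ^ j * x ^ q \<in> M" using j by blast
    next
      assume "\<exists>j<p. v ^ j * x ^ q \<in> M"
      then obtain j where j: "v ^ j * x ^ q \<in> M'" using MM' by blast
      have "v ^ j \<in> M'" using ext(2) subgrp_pow[OF sM'] by simp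
      then show "x ^ q \<in> M'" using subgrp_mult_left_iff[OF sM'] j by blast
    qed
    then show ?thesis by (auto simp: roots_def R_def)
  qed
  moreover have "R j \<inter> R l = {}" if "j < l" "l < p" for j l
  proof (rule ccontr)
    assume "R j \<inter> R l \<noteq> {}"
    then obtain x where x: "v ^ j * x ^ q \<in> M" "v ^ l * x ^ q \<in> M" by (auto simp: R_def)
    define d where "d = l - j"
    have d: "0 < d" "d < p" using that by (auto simp: d_def)
    have "v ^ l = v ^ d * v ^ j" using that by (simp add: d_def power_add[symmetric])
    then have "v ^ d * (v ^ j * x ^ q) \<in> M" using x by (simp add: mult.assoc)
    then have vd: "v ^ d \<in> M" using subgrp_mult_right_iff[OF sM x(1)] by blast
    \<comment> \<open>\<open>v ^ d\<close> and \<open>v ^ p\<close> lie in \<open>M\<close>, so a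
      Bezout relation for \<open>d\<close> and \<open>p\<close> puts \<open>v\<close> there
      too.\<close>
    have "coprime d p"
      using d prime_p by (metis coprime_commute nat_dvd_not_less prime_imp_coprime)
    then obtain a b where "d * a = p * b + 1" using bezout_nat[of d p] d by auto
    then have "(v ^ d) ^ a = (v ^ p) ^ b * v" by (simp add: power_mult[symmetric] power_add power_Suc2[symmetric] del: power_Suc)
    then have "v \<in> M"
      using subgrp_mult_left_iff[OF sM subgrp_pow[OF sM c3[OF v]]] subgrp_pow[OF sM vd] by metis
    then show False using u by (simp add: v_def)
  qed
  then have "disjoint_family_on R {..<p}"
    unfolding disjoint_family_on_def by (metis Int_commute lessThan_iff linorder_neqE_nat)
  ultimately have "card (roots G q M') = (\<Sum>j<p. card (R j))"
    using fG by (simp add: card_UN_disjoint' R_def)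
  then have "card (roots G q M') = p * card (roots G q M)" by (simp add: card_R)
  then show ?thesis using that[OF ext(1) MM' M'C] card_M' by simp
qed

text \<open>Iterating \<open>card_roots_step\<close> from \<open>M\<close> up to
  \<open>pow_sub C q\<close>; the cross-multiplied form avoids quotients.\<close>

lemma card_roots_pow_sub:
  assumes C: "normal_in C G" and Ck: "lcs C G k \<subseteq> pow_sub C q"
    and M: "normal_in M G" and MC: "M \<subseteq> pow_sub C q"
  shows "card (roots G q M) * card (pow_sub C q) = card (roots G q (pow_sub C q)) * card M"
  using M MC
proof (induction "card (pow_sub C q) - card M" arbitrary: M rule: less_induct)
  case less
  show ?case
  proof (cases "M = pow_sub C q")
    case False
    then have "M \<subset> pow_sub C q" using less by blast
    from card_roots_step[OF C less.prems(1) this Ck] obtain M' where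
      M': "normal_in M' G" "M \<subset> M'" "M' \<subseteq> pow_sub C q"
        "card (roots G q M') * card M = card (roots G q M) * card M'" by metis
    have fP: "finite (pow_sub C q)"
      using fG normal_in_subset[OF normal_in_pow_sub[OF sG C]] finite_subset by blast
    then have cM: "card M < card M'" "card M' \<le> card (pow_sub C q)" "0 < card M'"
      using M' by (auto simp: psubset_card_mono card_mono finite_subset intro: le_less_trans)
    then have "card (pow_sub C q) - card M' < card (pow_sub C q) - card M" by simp
    from less.hyps[OF this M'(1,3)]
    have IH: "card (roots G q M') * card (pow_sub C q) = card (roots G q (pow_sub C q)) * card M'" .
    have "(card (roots G q M) * card (pow_sub C q)) * card M' = (card (roots G q M) * card M') * card (pow_sub C q)"
      by (simp only: ac_simps)
    also have "\<dots> = (card (roots G q M') * card M) * card (pow_sub C q)" by (simp only: M'(4))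
    also have "\<dots> = (card (roots G q M') * card (pow_sub C q)) * card M" by (simp only: ac_simps)
    also have "\<dots> = (card (roots G q (pow_sub C q)) * card M') * card M" by (simp only: IH)
    also have "\<dots> = (card (roots G q (pow_sub C q)) * card M) * card M'" by (simp only: ac_simps)
    finally show ?thesis using cM by simp
  qed simp
qed

end

section \<open>Counting roots of unity\<close>

text \<open>Counting the related pairs in two ways. For a pairing with values in a group of order
  \<open>p\<close> with left kernel \<open>A'\<close> and right kernel \<open>B'\<close>, this is
  one of the two inequalities between the indices of the kernels.\<close>

lemma double_counting_bound:
  fixes R :: "'a \<Rightarrow> 'b \<Rightarrow> bool"
  assumes fin: "finite A" "finite B" and sub: "A' \<subseteq> A" "B' \<subseteq> B" and p: "1 < p"
    and A': "\<And>a. a \<in> A' \<Longrightarrow> card {b \<in> B. R a b} = card B"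
    and A: "\<And>a. a \<in> A \<Longrightarrow> card B \<le> p * card {b \<in> B. R a b}"
    and B: "\<And>b. b \<in> B - B' \<Longrightarrow> p * card {a \<in> A. R a b} \<le> card A"
  shows "card B * card A' \<le> card B' * card A"
proof -
  define a a' b b' where "a = card A" and "a' = card A'" and "b = card B" and "b' = card B'"
  have "(\<Sum>a\<in>A. card {b \<in> B. R a b}) = (\<Sum>a\<in>A. \<Sum>b\<in>B. if R a b then 1 else 0)"
    by (simp only: card_eq_sum sum.inter_filter[OF fin(2)] sum.inter_filter[OF fin(1)])
  also have "\<dots> = (\<Sum>b\<in>B. \<Sum>a\<in>A. if R a b then 1 else 0)" by (rule sum.swap)
  also have "\<dots> = (\<Sum>b\<in>B. card {a \<in> A. R a b})"
    by (simp only: card_eq_sum sum.inter_filter[OF fin(2)] sum.inter_filter[OF fin(1)])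
  finally have eq: "(\<Sum>a\<in>A. p * card {b \<in> B. R a b}) = (\<Sum>b\<in>B. p * card {a \<in> A. R a b})"
    by (simp add: sum_distrib_left[symmetric])
  have diff: "card (A - A') = a - a'" "card (B - B') = b - b'"
    using sub fin by (simp_all add: a_def a'_def b_def b'_def card_Diff_subset finite_subset[OF sub(1) fin(1)]
        finite_subset[OF sub(2) fin(2)])
  have "a' * (p * b) + (a - a') * b = (\<Sum>a\<in>A'. p * b) + (\<Sum>a\<in>A - A'. b)"
    by (simp add: diff a'_def)
  also have "\<dots> \<le> (\<Sum>a\<in>A'. p * card {b \<in> B. R a b}) + (\<Sum>a\<in>A - A'. p * card {b \<in> B. R a b})"
    using A A' by (intro add_mono sum_mono) (simp_all add: b_def)
  also have "\<dots> = (\<Sum>b\<in>B'. p * card {a \<in> A. R a b}) + (\<Sum>b\<in>B - B'. p * card {a \<in> A. R a b})"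
    using eq unfolding sum.subset_diff[OF sub(1) fin(1)] sum.subset_diff[OF sub(2) fin(2)] by linarith
  also have "\<dots> \<le> (\<Sum>b\<in>B'. p * a) + (\<Sum>b\<in>B - B'. a)"
    using B fin(1) by (intro add_mono sum_mono mult_le_mono2) (simp_all add: a_def card_mono)
  also have "\<dots> = b' * (p * a) + (b - b') * a"
    by (simp add: diff b'_def)
  finally have ineq: "a' * (p * b) + (a - a') * b \<le> b' * (p * a) + (b - b') * a" .
  have "a' \<le> a" "b' \<le> b" using fin sub by (auto simp: a_def a'_def b_def b'_def card_mono)
  then obtain d e where de: "a = a' + d" "b = b' + e" using le_Suc_ex by blast
  obtain p' where p': "p = Suc (Suc p')" using p less_imp_Suc_add[of 1 p] by auto
  \<comment> \<open>The common summand \<open>a * b\<close> cancels and leaves the factor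
    \<open>p - 1 = Suc p'\<close>.\<close>
  have "Suc p' * (b * a') \<le> Suc p' * (b' * a)"
    using ineq unfolding p' by (simp add: de algebra_simps)
  then have "b * a' \<le> b' * a" by (simp only: mult_le_cancel1)
  then show ?thesis by (simp add: a_def a'_def b_def b'_def)
qed

context potent_setup
begin

text \<open>\<open>G\<close> modulo \<open>M\<close> is regular: equal \<open>q\<close>-th powers of
  \<open>x\<close> and \<open>y\<close> modulo \<open>M\<close> force \<open>inverse x * y\<close>
  into \<open>roots G q M\<close>. So the fibres of the power map have at most that size, and its
  values are cosets in \<open>sprod (pow_sub G q) M\<close>.\<close>

lemma card_roots_regular:
  assumes M: "normal_in M G" and GM: "lcs G G k \<subseteq> M"
  shows "card G * card M \<le> card (roots G q M) * card (sprod (pow_sub G q) M)"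
proof -
  note nG = normal_in_self[OF sG] and sM = normal_in_subgrp[OF M]
  define H where "H = sprod (pow_sub G q) M"
  have H: "normal_in H G" unfolding H_def by (intro normal_in_sprod normal_in_pow_sub sG nG M)
  have fH: "finite H" using fG normal_in_subset[OF H] finite_subset by blast
  have MH: "M \<subseteq> H" "pow_sub G q \<subseteq> H" unfolding H_def using sprod_incl[OF subgrp_pow_sub sM] by auto
  have anti: "lcs G G n \<subseteq> M" if "k \<le> n" for n using lcs_antimono[OF sG nG nG that] GM by blast
  have "card G \<le> card (roots G q M) * card ((\<lambda>x. lcoset (x ^ q) M) ` G)"
  proof (rule card_le_cosets[OF fG sG])
    fix x y assume xy: "x \<in> G" "y \<in> G" and "lcoset (x ^ q) M = lcoset (y ^ q) M"
    then have "inverse (x ^ q) * y ^ q \<in> M" by (simp add: lcoset_eq_iff[OF sM])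
    moreover have "(inverse x * y) ^ q \<in> M \<longleftrightarrow> inverse (x ^ q) * (x * (inverse x * y)) ^ q \<in> M"
    proof (rule regular_mod[OF lcs_filtration[OF sG nG] sM prime_p i_pos, where t0 = 1 and t = 1])
      show "s ^ (p ^ (i - 1)) \<in> M" if "s \<in> lcs G G (p + 1 - 1 - 1)" for s
      proof -
        have "k \<le> p + 1 - 1 - 1" using k_less by linarith
        then show ?thesis using that anti by (intro subgrp_pow[OF sM]) blast
      qed
      show "lcs G G (p + 1 - 1) \<subseteq> M" using anti[of "p + 1 - 1"] k_less by simp
    qed (use xy sG in \<open>auto intro!: normal_in_conj[OF M] subgrp_mult subgrp_inv\<close>)
    ultimately show "inverse x * y \<in> roots G q M"
      using xy sG by (simp add: roots_def right_inv_cancel subgrp_mult subgrp_inv)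
  qed (auto simp: roots_def)
  also have "card ((\<lambda>x. lcoset (x ^ q) M) ` G) \<le> card ((\<lambda>x. lcoset x M) ` H)"
    using pow_in_pow_sub[of _ G q] subsetD[OF MH(2)] fH by (intro card_mono) blast+
  finally have "card G * card M \<le> card (roots G q M) * (card M * card ((\<lambda>x. lcoset x M) ` H))"
    by (metis (no_types, lifting) mult.assoc mult.commute mult_le_mono1 mult_le_mono2 order_trans)
  also have "card M * card ((\<lambda>x. lcoset x M) ` H) = card H"
    using card_eq_lcosets[OF fH normal_in_subgrp[OF H] sM MH(1)] by simp
  finally show ?thesis by (simp add: H_def)
qed

end

text \<open>One induction proves both claims, because equality for \<open>G\<close> forces equality
  for the smaller group \<open>C\<close>.\<close>

lemma card_roots_bound:
  fixes G :: "'a::mgroup set"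
  assumes p: "Factorial_Ring.prime p" and i: "0 < i" and k: "0 < k" "k < p" and ki: "k + 2 \<le> p \<or> 2 \<le> i"
    and G: "pgroup p G"
  defines "q \<equiv> p ^ i"
  shows "card G \<le> card (sprod (pow_sub G q) (lcs G G (k - 1))) * card (roots G q {1})"
    and "card G = card (sprod (pow_sub G q) (lcs G G (k - 1))) * card (roots G q {1}) \<Longrightarrow>
      lcs G G (k - 1) \<subseteq> pow_sub G q"
proof -
  have "card G \<le> card (sprod (pow_sub G q) (lcs G G (k - 1))) * card (roots G q {1}) \<and>
    (card G = card (sprod (pow_sub G q) (lcs G G (k - 1))) * card (roots G q {1}) \<longrightarrow>
      lcs G G (k - 1) \<subseteq> pow_sub G q)"
    using G
  proof (induction "card G" arbitrary: G rule: less_induct)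
    case less
    interpret potent_setup G p k i
      using p i k ki less.prems by unfold_locales
    note nG = normal_in_self[OF sG]
    define F where "F = sprod (pow_sub G q) (lcs G G (k - 1))"
    define Y where "Y = csub F G"
    define r where "r = card (roots G q {1})"
    have P: "normal_in (pow_sub G q) G" by (intro normal_in_pow_sub sG nG)
    have lG: "normal_in (lcs G G m) G" for m by (intro normal_in_lcs sG nG)
    have F: "normal_in F G" unfolding F_def by (intro normal_in_sprod sG P lG)
    have Y: "normal_in Y G" unfolding Y_def by (intro normal_in_csub sG F nG)
    have PF: "pow_sub G q \<subseteq> F" "lcs G G (k - 1) \<subseteq> F"
      unfolding F_def using sprod_incl[OF subgrp_pow_sub normal_in_subgrp[OF lG]] by auto
    have YF: "Y \<subseteq> F" unfolding Y_def by (rule csub_normal_subset[OF sG F order_refl])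
    have k_Suc: "lcs N H k = csub (lcs N H (k - 1)) H" for N H :: "'a set" using k by (cases k) auto
    have kY: "lcs G G k \<subseteq> Y" unfolding k_Suc Y_def by (intro csub_mono PF order_refl)
    note sF = normal_in_subgrp[OF F] and FG = normal_in_subset[OF F] and sY = normal_in_subgrp[OF Y]
    have fF: "finite F" using fG FG finite_subset by blast
    have fin_sub: "finite U" if "U \<subseteq> G" for U using fG that finite_subset by blast
    have r0: "0 < r"
      using fin_sub[of "roots G q {1}"] subgrp_one[OF sG] by (auto simp: r_def roots_def card_gt_0_iff)
    have F0: "0 < card F" using fF subgrp_one[OF sF] card_gt_0_iff by blast
    \<comment> \<open>In the case of equality the second bound gives
      \<open>card F \<le> card (pow_sub G q)\<close>, so these nested subgroups coincide.\<close>
    have finish: ?case if le: "card G \<le> card F * r" and eq: "card G = card F * r \<Longrightarrow> card G \<le> r * card (pow_sub G q)"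
    proof -
      have "lcs G G (k - 1) \<subseteq> pow_sub G q" if "card G = card F * r"
      proof -
        have "r * card F \<le> r * card (pow_sub G q)" using eq[OF that] that by (simp add: mult.commute)
        then have "card F \<le> card (pow_sub G q)" using r0 by simp
        then have "pow_sub G q = F" using card_seteq[OF fF PF(1)] by simp
        then show ?thesis using PF by simp
      qed
      then show ?thesis using le by (simp add: F_def r_def)
    qed
    show ?case
    proof (cases "Y \<subseteq> {1}")
      case True
      have "sprod (pow_sub G q) {1} = pow_sub G q" by (simp add: sprod_def)
      moreover have "lcs G G k \<subseteq> {1}" using kY True by blast
      ultimately have "card G \<le> r * card (pow_sub G q)"
        using card_roots_regular[OF normal_in_trivial[OF sG]] by (simp add: r_def q_def)
      moreover have "r * card (pow_sub G q) \<le> card F * r" using PF fF by (simp add: card_mono mult.commute)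
      ultimately show ?thesis by (intro finish) linarith+
    next
      case False
      then have "{1} \<subset> Y" using subgrp_one[OF sY] by auto
      from chief_factor[OF p pgroup_G Y normal_in_trivial[OF sG] this] obtain L
        where L: "normal_in L G" "L \<subset> Y" "card Y \<le> p * card L" "csub Y G \<subseteq> L" by metis
      note sL = normal_in_subgrp[OF L(1)]
      define C where "C = {g \<in> G. \<forall>u\<in>F. comm g u \<in> L}"
      define Z where "Z = F \<inter> {u \<in> G. \<forall>g\<in>G. comm u g \<in> L}"
      have sC: "subgrp C" unfolding C_def by (intro subgrp_comm_set sG L FG)
      have sZ: "subgrp Z" unfolding Z_def by (intro subgrp_Int sF subgrp_comm_set sG L order_refl)
      have CG: "C \<subseteq> G" by (auto simp: C_def)
      have C: "normal_in C G"
        unfolding normal_in_def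
      proof (intro conjI ballI sC CG)
        fix c g assume c: "c \<in> C" and g: "g \<in> G"
        have "comm (inverse g * c * g) u \<in> L" if "u \<in> F" for u
        proof -
          have "comm c (g * u * inverse g) \<in> L"
            using c normal_in_conj'[OF sG F that g] by (simp add: C_def)
          moreover have "comm (inverse g * c * g) u = inverse g * comm c (g * u * inverse g) * g"
            by (simp add: comm_def word_simps)
          ultimately show ?thesis using normal_in_conj[OF L(1) _ g] by simp
        qed
        then show "inverse g * c * g \<in> C"
          using normal_in_conj[OF nG _ g] c CG by (auto simp: C_def)
      qed
      have LZ: "L \<subseteq> Z"
        using L YF FG comm_in_normal[OF sG L(1)] by (auto simp: Z_def)
      have Z: "normal_in Z G"
        unfolding normal_in_def
      proof (intro conjI ballI sZ)
        show "Z \<subseteq> G" by (auto simp: Z_def)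
        fix z g assume z: "z \<in> Z" and g: "g \<in> G"
        then have "comm z g \<in> L" by (simp add: Z_def)
        then show "inverse g * z * g \<in> Z"
          using z LZ subgrp_mult[OF sZ] unfolding conj_eq_comm by blast
      qed
      have ZF: "Z \<subseteq> F" by (auto simp: Z_def)
      have YZ: "Y \<subseteq> Z" using YF L(4) FG comm_in_csub by (force simp: Z_def)
      have CF: "comm u c \<in> L" if "u \<in> F" "c \<in> C" for u c
        using that comm_in_swap[OF sL, of u c] unfolding C_def by blast
      have "C \<noteq> G"
      proof
        assume "C = G"
        then have "Y \<subseteq> L" unfolding Y_def using CF by (intro csub_least sL) auto
        then show False using L by blast
      qed
      then have cC: "card C < card G" using CG fG by (simp add: psubset_card_mono)
      have count: "card G * card Z \<le> card C * card F"
      proof (rule double_counting_bound[where R = "\<lambda>u g. comm u g \<in> L", OF fF fG ZF CG prime_gt_1_nat[OF p]])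
        fix u assume "u \<in> Z"
        then have "{g \<in> G. comm u g \<in> L} = G" by (auto simp: Z_def)
        then show "card {g \<in> G. comm u g \<in> L} = card G" by simp
      next
        fix u assume u: "u \<in> F"
        have cY: "comm u g \<in> Y" if "g \<in> G" for g unfolding Y_def using u that by (rule comm_in_csub)
        \<comment> \<open>For fixed \<open>u\<close> the commutators take at most \<open>p\<close>
          values modulo \<open>L\<close>, and each fibre lies in a coset of the centralizer of
          \<open>u\<close> modulo \<open>L\<close>.\<close>
        have "card G \<le> card {g \<in> G. comm u g \<in> L} * card ((\<lambda>g. lcoset (comm u g) L) ` G)"
        proof (rule card_le_cosets[OF fG sG])
          fix g h assume gh: "g \<in> G" "h \<in> G" and "lcoset (comm u g) L = lcoset (comm u h) L"
          then have l: "inverse (comm u g) * comm u h \<in> L" by (simp add: lcoset_eq_iff[OF sL])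
          define m c where "m = inverse g * h" and "c = comm u g"
          have m: "m \<in> G" using gh sG by (simp add: m_def subgrp_closed)
          have cm: "comm c m \<in> L" unfolding c_def using L(4) comm_in_csub[OF cY[OF gh(1)] m] by blast
          have "inverse c * comm u h = (inverse c * comm u m * c) * comm c m"
            by (simp add: c_def m_def comm_def word_simps)
          then have "inverse c * comm u m * c \<in> L"
            using l subgrp_mult_right_iff[OF sL cm] by (simp add: c_def)
          then have "comm u m \<in> L"
            using normal_in_conj_iff[OF sG L(1)] cY[OF gh(1)] normal_in_subset[OF Y] by (auto simp: c_def)
          then show "inverse g * h \<in> {g \<in> G. comm u g \<in> L}" using m by (simp add: m_def)
        qed auto
        also have "card ((\<lambda>g. lcoset (comm u g) L) ` G) \<le> card ((\<lambda>y. lcoset y L) ` Y)"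
          using cY fin_sub[OF normal_in_subset[OF Y]] by (intro card_mono) auto
        also have "\<dots> \<le> p"
        proof -
          have "card Y = card L * card ((\<lambda>y. lcoset y L) ` Y)"
            using L by (intro card_eq_lcosets fin_sub[OF normal_in_subset[OF Y]] sY sL) auto
          then have "card L * card ((\<lambda>y. lcoset y L) ` Y) \<le> card L * p" using L(3) by (simp add: mult.commute)
          moreover have "0 < card L"
            using fin_sub[OF normal_in_subset[OF L(1)]] subgrp_one[OF sL] card_gt_0_iff by blast
          ultimately show ?thesis by simp
        qed
        finally show "card G \<le> p * card {g \<in> G. comm u g \<in> L}" by (simp add: mult.commute)
      next
        fix g assume g: "g \<in> G - C"
        have "subgrp (F \<inter> {u \<in> G. \<forall>b\<in>{g}. comm u b \<in> L})"
          using g by (intro subgrp_Int sF subgrp_comm_set sG L) auto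
        moreover have "F \<inter> {u \<in> G. \<forall>b\<in>{g}. comm u b \<in> L} = {u \<in> F. comm u g \<in> L}" using FG by auto
        ultimately have "subgrp {u \<in> F. comm u g \<in> L}" by simp
        moreover have "{u \<in> F. comm u g \<in> L} \<noteq> F" using g comm_in_swap[OF sL, of g] unfolding C_def by blast
        ultimately show "p * card {u \<in> F. comm u g \<in> L} \<le> card F"
          using pgroup_index(2)[OF p pgroup_sub[OF p pgroup_G sF FG]] by (simp add: psubset_eq)
      qed
      define FC where "FC = sprod (pow_sub C q) (lcs C C (k - 1))"
      have "lcs C C (k - 1) \<subseteq> Z"
      proof -
        have "lcs C C (k - 1) \<subseteq> F" using lcs_mono[OF CG CG] PF by blast
        \<comment> \<open>This commutator subgroup lies in the one of \<open>G\<close> with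
          \<open>k\<close> factors \<open>C\<close>; the last factor is paired with a subgroup of
          \<open>lcs G G (k - 1)\<close>, hence of \<open>F\<close>, and \<open>C\<close>
          centralizes \<open>F\<close> modulo \<open>L\<close>.\<close>
        moreover have "csub G (lcs C C (k - 1)) \<subseteq> L"
        proof -
          have "csub G (lcs C C (k - 1)) \<subseteq> lcs G C k"
            using csub_lcs_lcs[OF sG nG C, of 0 "k - 1"] k by simp
          also have "\<dots> \<subseteq> csub F C" unfolding k_Suc using lcs_mono[OF order_refl CG, of G "k - 1"] PF by (intro csub_mono) auto
          also have "\<dots> \<subseteq> L" using CF by (intro csub_least sL) auto
          finally show ?thesis .
        qed
        ultimately show ?thesis
          using FG comm_in_csub[of _ G _ "lcs C C (k - 1)"] comm_in_swap[OF sL] unfolding Z_def by blast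
      qed
      moreover have "pow_sub C q \<subseteq> Z"
      proof (rule pow_sub_least[OF sZ])
        fix c assume c: "c \<in> C"
        have k1: "lcs G G n \<subseteq> L" if "Suc k \<le> n" for n
        proof -
          have "lcs G G (Suc k) \<subseteq> csub Y G" using kY by (simp add: csub_mono)
          then show ?thesis using lcs_antimono[OF sG nG nG that] L(4) by blast
        qed
        \<comment> \<open>Elements of the derived subgroup have weight 2, so it is enough that
          \<open>lcs G G p\<close> lies in \<open>L\<close>, which follows from
          \<open>k < p\<close>.\<close>
        have reg: "y ^ q \<in> L \<longleftrightarrow> inverse (a ^ q) * (a * y) ^ q \<in> L"
          if "a \<in> G" "y \<in> lcs G G 1" for a y
          unfolding q_def
        proof (rule regular_mod[OF lcs_filtration[OF sG nG] sL p i, where t0 = 2 and t = 2])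
          show "lcs G G (p + 2 - 1) \<subseteq> L" using k1[of "p + 2 - 1"] k by simp
          show "s ^ (p ^ (i - 1)) \<in> L" if "s \<in> lcs G G (p + 2 - 1 - 1)" for s
            using that k k1[of "p + 2 - 1 - 1"] by (intro subgrp_pow[OF sL]) auto
        qed (use that in \<open>auto intro: normal_in_conj[OF L(1)]\<close>)
        have comm_pow: "inverse (a ^ q) * (a * comm a b) ^ q = comm (a ^ q) b" for a b :: 'a
          unfolding conj_eq_comm[symmetric] conj_pow by (simp add: comm_def word_simps)
        \<comment> \<open>Regularity is used twice. Since \<open>g ^ q\<close> is in
          \<open>F\<close>, it commutes with \<open>c\<close> modulo \<open>L\<close>, so
          \<open>comm g c ^ q\<close> is in \<open>L\<close>; inverting the commutator and going
          back moves the power onto \<open>c\<close>.\<close>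
        have "comm (c ^ q) g \<in> L" if g: "g \<in> G" for g
        proof -
          have cG: "c \<in> G" using c CG by blast
          have "comm (g ^ q) c \<in> L" using pow_in_pow_sub[OF g] PF c by (intro CF) auto
          then have "comm g c ^ q \<in> L" using reg[OF g, of "comm g c"] comm_in_csub[OF g cG] comm_pow by simp
          then have "inverse (comm g c ^ q) \<in> L" by (rule subgrp_inv[OF sL])
          then have "comm c g ^ q \<in> L" by (simp add: inv_pow[symmetric] comm_inv)
          then show ?thesis using reg[OF cG, of "comm c g"] comm_in_csub[OF cG g] comm_pow by simp
        qed
        moreover have "c ^ q \<in> F" using c CG PF pow_in_pow_sub by blast
        ultimately show "c ^ q \<in> Z" using FG by (auto simp: Z_def)
      qed
      ultimately have FCZ: "FC \<subseteq> Z" unfolding FC_def by (intro sprod_least sZ)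
      define rC where "rC = card (roots C q {1})"
      have IH: "card C \<le> card FC * rC" "card C = card FC * rC \<Longrightarrow> lcs C C (k - 1) \<subseteq> pow_sub C q"
        using less.hyps[OF cC pgroup_sub[OF p pgroup_G sC CG]] by (auto simp: FC_def rC_def)
      have fc: "card FC \<le> card Z" using FCZ fin_sub[OF normal_in_subset[OF Z]] by (rule card_mono[rotated])
      have rC: "rC \<le> r" unfolding rC_def r_def using CG fG by (intro card_mono) (auto simp: roots_def)
      have z0: "0 < card Z" using fin_sub[OF normal_in_subset[OF Z]] subgrp_one[OF sZ] card_gt_0_iff by blast
      have chain: "card C * card F \<le> (card FC * rC) * card F" "(card FC * rC) * card F \<le> (card Z * r) * card F"
        using IH(1) fc rC by (auto intro!: mult_le_mono)
      show ?thesis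
      proof (rule finish)
        have "card G * card Z \<le> (card Z * r) * card F" using order_trans[OF count order_trans[OF chain]] .
        then have "card G * card Z \<le> (card F * r) * card Z" by (simp only: ac_simps)
        then show "card G \<le> card F * r" using z0 by simp
      next
        assume eq: "card G = card F * r"
        then have "card G * card Z = (card Z * r) * card F" by (simp only: ac_simps)
        \<comment> \<open>Equality for \<open>G\<close> makes every inequality in
          \<open>count\<close> and \<open>chain\<close> an equality. This gives
          \<open>FC = Z\<close> and activates the second half of the induction hypothesis for
          \<open>C\<close>.\<close>
        then have "card C * card F = (card FC * rC) * card F" "(card FC * rC) * card F = (card Z * r) * card F"
          using count chain by linarith+
        then have e1: "card C = card FC * rC" and e2: "card FC * rC = card Z * r" using F0 by simp_all
        have "card FC = card Z"
        proof (rule ccontr)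
          assume "card FC \<noteq> card Z"
          then have "card FC * r < card Z * r" using fc r0 by simp
          moreover have "card FC * rC \<le> card FC * r" using rC by simp
          ultimately show False using e2 by simp
        qed
        then have "FC = Z" using FCZ fin_sub[OF normal_in_subset[OF Z]] by (simp add: card_subset_eq)
        moreover have "FC \<subseteq> pow_sub C q" unfolding FC_def using IH(2)[OF e1] by (intro sprod_least subgrp_pow_sub order_refl)
        ultimately have ZC: "Z = pow_sub C q" using \<open>pow_sub C q \<subseteq> Z\<close> by blast
        have kZ: "lcs G G k \<subseteq> Z" using kY YZ by blast
        then have "lcs C G k \<subseteq> pow_sub C q" using lcs_mono[OF CG order_refl] ZC by blast
        \<comment> \<open>\<open>Z\<close> is now the \<open>q\<close>-th power subgroup of
          \<open>C\<close>, so the ratio of roots to order is the same for \<open>Z\<close> as for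
          the trivial group. Regularity modulo \<open>Z\<close> then bounds \<open>card G\<close>,
          and \<open>Z\<close> is absorbed by \<open>pow_sub G q\<close>.\<close>
        from card_roots_pow_sub[OF C this[unfolded q_def] normal_in_trivial[OF sG]]
        have rZ: "card (roots G q Z) = r * card Z"
          using subgrp_one[OF sZ] by (simp add: r_def q_def ZC)
        have PZ: "sprod (pow_sub G q) Z = pow_sub G q"
          using sprod_least[OF subgrp_pow_sub order_refl, of Z G q] sprod_incl(1)[OF subgrp_pow_sub sZ]
            pow_sub_mono[OF CG] ZC by blast
        have "card G * card Z \<le> card (roots G q Z) * card (sprod (pow_sub G q) Z)"
          using card_roots_regular[OF Z kZ] by (simp add: q_def)
        also have "\<dots> = (r * card (pow_sub G q)) * card Z" by (simp only: rZ PZ ac_simps)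
        finally have "card G * card Z \<le> (r * card (pow_sub G q)) * card Z" .
        then show "card G \<le> r * card (pow_sub G q)" using z0 by simp
      qed
    qed
  qed
  then show "card G \<le> card (sprod (pow_sub G q) (lcs G G (k - 1))) * card (roots G q {1})"
    and "card G = card (sprod (pow_sub G q) (lcs G G (k - 1))) * card (roots G q {1}) \<Longrightarrow>
      lcs G G (k - 1) \<subseteq> pow_sub G q"
    by blast+
qed

text \<open>Forward, the ratio for \<open>C = G\<close> is compared at the trivial group and at
  \<open>pow_sub G q\<close>, whose set of roots is all of \<open>G\<close>. Backward is the
  equality case of the bound.\<close>

lemma lcs_le_pow_sub_iff:
  fixes G :: "'a::mgroup set"
  assumes p: "Factorial_Ring.prime p" and i: "0 < i" and k: "0 < k" "k < p" and ki: "k + 2 \<le> p \<or> 2 \<le> i"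
    and G: "pgroup p G"
  shows "lcs G G (k - 1) \<subseteq> pow_sub G (p ^ i) \<longleftrightarrow>
    card G = card (sprod (pow_sub G (p ^ i)) (lcs G G (k - 1))) * card (roots G (p ^ i) {1})"
proof
  interpret potent_setup G p k i using p i k ki G by unfold_locales
  note nG = normal_in_self[OF sG]
  assume le: "lcs G G (k - 1) \<subseteq> pow_sub G q"
  have "lcs G G k \<subseteq> pow_sub G q" using lcs_antimono[OF sG nG nG, of "k - 1" k] le by auto
  from card_roots_pow_sub[OF nG this normal_in_trivial[OF sG]]
  have "card (roots G q {1}) * card (pow_sub G q) = card (roots G q (pow_sub G q))"
    using subgrp_one[OF subgrp_pow_sub] by auto
  also have "roots G q (pow_sub G q) = G" by (auto simp: roots_def pow_in_pow_sub)
  finally have "card (roots G q {1}) * card (pow_sub G q) = card G" .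
  moreover have "sprod (pow_sub G q) (lcs G G (k - 1)) = pow_sub G q"
    using sprod_least[OF subgrp_pow_sub order_refl le]
      sprod_incl(1)[OF subgrp_pow_sub normal_in_subgrp[OF normal_in_lcs[OF sG nG nG]]] by blast
  ultimately show "card G = card (sprod (pow_sub G q) (lcs G G (k - 1))) * card (roots G q {1})"
    by (simp add: mult.commute)
qed (use card_roots_bound(2)[OF p i k ki G] in blast)

section \<open>Cayley embedding into a type of class \<open>mgroup\<close>\<close>

text \<open>The symmetric group on a type: an instance of \<open>mgroup\<close> large enough to
  contain every group whose carrier lies in that type.\<close>

typedef 'a sym = "{f :: 'a \<Rightarrow> 'a. bij f}"
  morphisms sym_apply Sym
  using bij_id by blast

setup_lifting type_definition_sym

instantiation sym :: (type) mgroup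
begin

lift_definition one_sym :: "'a sym" is id by (rule bij_id)
lift_definition times_sym :: "'a sym \<Rightarrow> 'a sym \<Rightarrow> 'a sym" is "(\<circ>)" by (rule bij_comp)
lift_definition inverse_sym :: "'a sym \<Rightarrow> 'a sym" is "inv_into UNIV" by (rule bij_imp_bij_inv)
definition divide_sym :: "'a sym \<Rightarrow> 'a sym \<Rightarrow> 'a sym" where "divide_sym f g = f * inverse g"

instance
proof
  fix f g h :: "'a sym"
  show "f * g * h = f * (g * h)" by transfer (rule comp_assoc)
  show "1 * f = f" by transfer simp
  show "f * 1 = f" by transfer simp
  show "inverse f * f = 1" by transfer (simp add: bij_is_inj)
qed

end

locale cayley_embedding = group
begin

text \<open>Left multiplication, extended by the identity outside the carrier to a permutation of
  the whole type.\<close>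

definition cayley :: "'a \<Rightarrow> 'a sym" where
  "cayley x = Sym (\<lambda>y. if y \<in> carrier G then x \<otimes> y else y)"

lemma sym_apply_cayley:
  assumes "x \<in> carrier G"
  shows "sym_apply (cayley x) = (\<lambda>y. if y \<in> carrier G then x \<otimes> y else y)"
  unfolding cayley_def
proof (rule Sym_inverse, safe)
  show "bij (\<lambda>y. if y \<in> carrier G then x \<otimes> y else y)"
    by (rule o_bij[where g = "\<lambda>y. if y \<in> carrier G then inv x \<otimes> y else y"])
      (use assms in \<open>auto simp: fun_eq_iff m_assoc[symmetric]\<close>)
qed

lemma cayley_mult: "x \<in> carrier G \<Longrightarrow> y \<in> carrier G \<Longrightarrow> cayley (x \<otimes> y) = cayley x * cayley y"
  by (auto simp: sym_apply_inject[symmetric] times_sym.rep_eq sym_apply_cayley fun_eq_iff m_assoc)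

lemma cayley_one: "cayley \<one> = 1"
  by (auto simp: sym_apply_inject[symmetric] one_sym.rep_eq sym_apply_cayley fun_eq_iff)

lemma cayley_inv: "x \<in> carrier G \<Longrightarrow> cayley (inv x) = inverse (cayley x)"
  using cayley_mult[of "inv x" x] cayley_one by (metis inv_closed inv_inv inv_mult_eq_iff l_inv mult_1_right)

lemma cayley_inj: "inj_on cayley (carrier G)"
proof (rule inj_onI)
  fix x y assume xy: "x \<in> carrier G" "y \<in> carrier G" "cayley x = cayley y"
  then have "sym_apply (cayley x) \<one> = sym_apply (cayley y) \<one>" by simp
  then show "x = y" using xy(1,2) by (simp add: sym_apply_cayley)
qed

lemma cayley_pow: "x \<in> carrier G \<Longrightarrow> cayley (x [^] (n::nat)) = cayley x ^ n"
  by (induction n) (simp_all add: cayley_one cayley_mult power_Suc2 del: power_Suc)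

lemma cayley_subgroup_iff:
  assumes "H \<subseteq> carrier G"
  shows "subgrp (cayley ` H) \<longleftrightarrow> subgroup H G"
proof
  assume H: "subgroup H G"
  then show "subgrp (cayley ` H)"
    using subgroup.one_closed[OF H] subgroup.m_closed[OF H] subgroup.m_inv_closed[OF H] assms
    unfolding subgrp_def
    by (auto simp: cayley_one[symmetric] cayley_mult[symmetric] cayley_inv[symmetric] subset_iff)
next
  assume H: "subgrp (cayley ` H)"
  have mem: "x \<in> H \<longleftrightarrow> cayley x \<in> cayley ` H" if "x \<in> carrier G" for x
    using inj_on_image_mem_iff[OF cayley_inj that assms] by simp
  show "subgroup H G"
  proof (rule subgroupI[OF assms])
    have "\<one> \<in> H" using subgrp_one[OF H] by (simp add: mem cayley_one)
    then show "H \<noteq> {}" by blast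
    fix x assume x: "x \<in> H"
    then show "inv x \<in> H"
      using assms subgrp_inv[OF H] by (subst mem) (auto simp: cayley_inv subset_iff)
    fix y assume "y \<in> H"
    with x show "x \<otimes> y \<in> H"
      using assms subgrp_mult[OF H] by (subst mem) (auto simp: cayley_mult subset_iff)
  qed
qed

lemma cayley_generate:
  assumes "S \<subseteq> carrier G"
  shows "cayley ` generate G S = gen (cayley ` S)"
proof
  have sub: "generate G S \<subseteq> carrier G" using generate_incl[OF assms] .
  show "cayley ` generate G S \<subseteq> gen (cayley ` S)"
  proof safe
    fix x assume "x \<in> generate G S"
    then show "cayley x \<in> gen (cayley ` S)"
    proof induction
      case one
      then show ?case by (simp add: cayley_one subgrp_one subgrp_gen)
    next
      case (incl h)
      then show ?case by (intro gen_incl) simp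
    next
      case (inv h)
      then have "inverse (cayley h) \<in> gen (cayley ` S)" by (intro subgrp_inv[OF subgrp_gen] gen_incl imageI)
      then show ?case using inv assms by (simp add: cayley_inv subset_iff)
    next
      case (eng h1 h2)
      then show ?case using sub by (simp add: cayley_mult subset_iff subgrp_mult[OF subgrp_gen])
    qed
  qed
  show "gen (cayley ` S) \<subseteq> cayley ` generate G S"
    using generate_is_subgroup[OF assms] sub
    by (intro gen_least) (auto simp: cayley_subgroup_iff intro: generate.incl)
qed

text \<open>
  \<open>comm x y\<close> is \<open>x\<inverse> y\<inverse> x y\<close>, while \<open>commutator_subgroup\<close> uses \<open>x y x\<inverse> y\<inverse>\<close>.
\<close>
lemma cayley_commutator_subgroup:
  assumes A: "subgroup A G" and B: "subgroup B G"
  shows "cayley ` commutator_subgroup G A B = csub (cayley ` A) (cayley ` B)"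
proof -
  note sub = subgroup.subset[OF A] subgroup.subset[OF B]
  have comm: "comm (cayley x) (cayley y) = cayley (inv x \<otimes> inv y \<otimes> inv (inv x) \<otimes> inv (inv y))"
    if "x \<in> A" "y \<in> B" for x y
    using that sub by (auto simp: comm_def cayley_mult cayley_inv subset_iff)
  have "cayley ` {x \<otimes> y \<otimes> inv x \<otimes> inv y | x y. x \<in> A \<and> y \<in> B}
      = {comm a b | a b. a \<in> cayley ` A \<and> b \<in> cayley ` B}" (is "?L = ?R")
  proof
    show "?L \<subseteq> ?R"
    proof clarify
      fix x y assume xy: "x \<in> A" "y \<in> B"
      then have "inv x \<in> A" "inv y \<in> B" by (simp_all add: A B subgroup.m_inv_closed)
      moreover from this have "cayley (x \<otimes> y \<otimes> inv x \<otimes> inv y) = comm (cayley (inv x)) (cayley (inv y))"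
        using xy sub by (simp add: comm subset_iff)
      ultimately show "\<exists>a b. cayley (x \<otimes> y \<otimes> inv x \<otimes> inv y) = comm a b \<and> a \<in> cayley ` A \<and> b \<in> cayley ` B"
        by blast
    qed
    show "?R \<subseteq> ?L"
    proof clarify
      fix x y assume xy: "x \<in> A" "y \<in> B"
      then have "inv x \<in> A" "inv y \<in> B" by (simp_all add: A B subgroup.m_inv_closed)
      then show "comm (cayley x) (cayley y) \<in> ?L" unfolding comm[OF xy] by blast
    qed
  qed
  moreover have "{x \<otimes> y \<otimes> inv x \<otimes> inv y | x y. x \<in> A \<and> y \<in> B} \<subseteq> carrier G"
    using subsetD[OF sub(1)] subsetD[OF sub(2)] by auto
  ultimately show ?thesis
    unfolding commutator_subgroup_def csub_def by (simp add: cayley_generate)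
qed

lemma subgroup_commutator_subgroup:
  "A \<subseteq> carrier G \<Longrightarrow> B \<subseteq> carrier G \<Longrightarrow> subgroup (commutator_subgroup G A B) G"
  unfolding commutator_subgroup_def by (rule generate_is_subgroup) (blast intro: m_closed inv_closed)

lemma subgroup_lower_central: "subgroup (lower_central G (Suc n)) G"
  by (induction n) (auto simp: subgroup_self intro!: subgroup_commutator_subgroup dest: subgroup.subset)

lemma cayley_lower_central:
  "cayley ` lower_central G (Suc n) = lcs (cayley ` carrier G) (cayley ` carrier G) n"
proof (induction n)
  case (Suc n)
  then show ?case
    using cayley_commutator_subgroup[OF subgroup_lower_central[of n] subgroup_self] by simp
qed simp

lemma cayley_power_subgroup:
  "cayley ` power_subgroup G m = pow_sub (cayley ` carrier G) m"
proof -
  have "cayley ` {x [^] m | x. x \<in> carrier G} = {x ^ m | x. x \<in> cayley ` carrier G}"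
    by (auto simp: cayley_pow image_iff) (metis cayley_pow)
  moreover have "{x [^] m | x. x \<in> carrier G} \<subseteq> carrier G" by auto
  ultimately show ?thesis
    unfolding power_subgroup_def pow_sub_def by (simp add: cayley_generate)
qed

lemma cayley_Omega_set:
  "cayley ` Omega_set G p i = roots (cayley ` carrier G) (p ^ i) {1}"
proof -
  have "x [^] (p ^ i) = \<one> \<longleftrightarrow> cayley x ^ (p ^ i) = 1" if "x \<in> carrier G" for x
    using inj_on_eq_iff[OF cayley_inj, of "x [^] (p ^ i)" \<one>] that by (simp add: cayley_pow cayley_one)
  then show ?thesis by (auto simp: Omega_set_def roots_def)
qed

lemma cayley_set_mult:
  assumes "A \<subseteq> carrier G" "B \<subseteq> carrier G"
  shows "cayley ` (A <#> B) = sprod (cayley ` A) (cayley ` B)"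
proof -
  have "cayley (a \<otimes> b) = cayley a * cayley b" if "a \<in> A" "b \<in> B" for a b
    using that assms by (simp add: cayley_mult subset_iff)
  then show ?thesis
    unfolding set_mult_def sprod_def by (auto simp: image_iff) (metis+)
qed

end

theorem theoremB:
  fixes G (structure) and p k i :: nat
  assumes "Factorial_Ring.prime p" and "odd p"
    and "finite_p_group p G"
    and "k \<ge> 1" and "i \<ge> 1"
    and "(k \<le> p - 2 \<and> i \<ge> 1) \<or> (k = p - 1 \<and> i \<ge> 2)"
  shows "lower_central G k \<subseteq> power_subgroup G (p ^ i) \<longleftrightarrow>
    subgroup_index G (power_subgroup G (p ^ i) <#> lower_central G k) = card (Omega_set G p i)"
proof -
  interpret cayley_embedding G
    using assms(3) by (simp add: cayley_embedding_def finite_p_group_def)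
  have fin: "finite (carrier G)" and ord: "\<exists>n. order G = p ^ n"
    using assms(3) by (simp_all add: finite_p_group_def)
  define H where "H = cayley ` carrier G"
  define A where "A = power_subgroup G (p ^ i) <#> lower_central G k"
  have k_Suc: "Suc (k - 1) = k" using assms(4) by simp
  have L: "subgroup (lower_central G k) G" using subgroup_lower_central[of "k - 1"] unfolding k_Suc .
  have P: "subgroup (power_subgroup G (p ^ i)) G"
    unfolding power_subgroup_def by (intro generate_is_subgroup) auto
  note subL = subgroup.subset[OF L] and subP = subgroup.subset[OF P]
  have sub\<Omega>: "Omega_set G p i \<subseteq> carrier G" by (auto simp: Omega_set_def)
  have card: "card (cayley ` B) = card B" if "B \<subseteq> carrier G" for B
    using inj_on_subset[OF cayley_inj that] by (rule card_image)
  have imL: "cayley ` lower_central G k = lcs H H (k - 1)"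
    using cayley_lower_central[of "k - 1"] unfolding k_Suc H_def .
  have imP: "cayley ` power_subgroup G (p ^ i) = pow_sub H (p ^ i)"
    by (simp add: cayley_power_subgroup H_def)
  have imA: "cayley ` A = sprod (pow_sub H (p ^ i)) (lcs H H (k - 1))"
    by (simp add: A_def cayley_set_mult[OF subP subL] imP imL)
  have H: "pgroup p H"
    using fin ord card[OF order_refl] subgroup_self
    by (simp add: pgroup_def H_def order_def cayley_subgroup_iff)
  have sH: "subgrp H" using H by (rule pgroup_subgrp)
  have subA: "A \<subseteq> carrier G" unfolding A_def using subP subL by (rule set_mult_closed)
  have "subgrp (cayley ` A)"
    unfolding imA
    by (intro subgrp_sprod[OF sH subgrp_pow_sub pow_sub_subset[OF sH]] normal_in_lcs sH normal_in_self)
  then have A: "subgroup A G" using subA by (simp add: cayley_subgroup_iff)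
  have A0: "0 < card A" using subgroup.one_closed[OF A] finite_subset[OF subA fin] card_gt_0_iff by blast
  \<comment> \<open>Lagrange's theorem converts the index condition into the product form used for
    \<open>H\<close>; it requires that \<open>A\<close> is a subgroup.\<close>
  have index: "card (carrier G) = subgroup_index G A * card A"
    using lagrange[OF A] by (simp add: subgroup_index_def order_def)
  \<comment> \<open>This makes the truncated subtractions \<open>p - 2\<close> and
    \<open>p - 1\<close> in the hypotheses genuine.\<close>
  have p2: "2 \<le> p" using assms(1) by (rule prime_ge_2_nat)
  have "lower_central G k \<subseteq> power_subgroup G (p ^ i) \<longleftrightarrow> lcs H H (k - 1) \<subseteq> pow_sub H (p ^ i)"
    unfolding imL[symmetric] imP[symmetric]
    using inj_on_image_mem_iff[OF cayley_inj _ subP] subL by blast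
  also have "\<dots> \<longleftrightarrow> card H = card (sprod (pow_sub H (p ^ i)) (lcs H H (k - 1))) * card (roots H (p ^ i) {1})"
    using assms p2 by (intro lcs_le_pow_sub_iff H) auto
  also have "\<dots> \<longleftrightarrow> card (carrier G) = card A * card (Omega_set G p i)"
    using card[OF subA] card[OF sub\<Omega>] card[OF order_refl]
    by (simp add: imA cayley_Omega_set H_def)
  also have "\<dots> \<longleftrightarrow> subgroup_index G A = card (Omega_set G p i)"
    unfolding index using A0 by (metis mult.commute mult_cancel2 not_gr_zero)
  finally show ?thesis by (simp add: A_def)
qed

end
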